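(* Let $n\ge1$. For all $(n+1)$-tuples $\mathbf{m}=(m_0,m_1,\ldots,m_n)$ of positive integers, the $*$-algebras $\mathcal{O}(L^{2n+1}_q(\prod_{i=0}^n m_i;\mathbf{m}))$ and $\mathcal{O}(\Sigma^{2n+1}_q(\prod_{i=0}^n m_i;\mathbf{m}))$ are strongly $\mathbb{Z}$-graded. In other words, the quantum lens space $L^{2n+1}_q(\prod_i m_i;\mathbf{m})$ is a circle principal bundle over the quantum weighted projective space $\mathbb{WP}^n_q(\mathbf{m})$, and $\Sigma^{2n+1}_q(\prod_i m_i;\mathbf{m})$ is a circle principal bundle over $\mathbb{RP}^{2n}_q(\mathbf{m})$.
   Context: Fix a real number $q\in(0,1)$. The algebra $\mathcal{O}(S^{2n+1}_q)$ is the unital complex $*$-algebra generated by $z_0,\ldots,z_n$ subject to the relations $$z_iz_j=qz_jz_i\ (i<j),\qquad z_iz_j^*=qz_j^*z_i\ (i\ne j),$$ $$z_iz_i^*=z_i^*z_i+(q^{-2}-1)\sum_{j=i+1}^n z_jz_j^*,\qquad \sum_{j=0}^n z_jz_j^*=1.$$ The algebra $\mathcal{O}(\Sigma^{2n+1}_q)$ is the unital complex $*$-algebra generated by $z_0,\ldots,z_n$ and a central unitary $w$, subject to the same relations together with $z_n^*=wz_n$. For positive integers $\mathbf{m}=(m_0,\ldots,m_n)$, both algebras are $\mathbb{Z}$-graded by $|z_i|_{\mathbb{Z}}=m_i$, $|z_i^*|_{\mathbb{Z}}=-m_i$ (so that $|w|_{\mathbb{Z}}=-2m_n$ in the second case).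 The degree-zero part of $\mathcal{O}(S^{2n+1}_q)$ is denoted $\mathcal{O}(\mathbb{WP}^n_q(\mathbf{m}))$, and that of $\mathcal{O}(\Sigma^{2n+1}_q)$ is denoted $\mathcal{O}(\mathbb{RP}^{2n}_q(\mathbf{m}))$. For a positive integer $N$, $\mathcal{O}(L^{2n+1}_q(N;\mathbf{m}))\subseteq\mathcal{O}(S^{2n+1}_q)$, respectively $\mathcal{O}(\Sigma^{2n+1}_q(N;\mathbf{m}))\subseteq\mathcal{O}(\Sigma^{2n+1}_q)$, is the direct sum of all homogeneous components of $\mathbb{Z}$-degree divisible by $N$. It is itself $\mathbb{Z}$-graded: an element has degree $k$ if its degree in the ambient algebra is $kN$. Its degree-zero part is $\mathcal{O}(\mathbb{WP}^n_q(\mathbf{m}))$, respectively $\mathcal{O}(\mathbb{RP}^{2n}_q(\mathbf{m}))$. A $\mathbb{Z}$-graded algebra $\mathcal{A}=\bigoplus_{k\in\mathbb{Z}}\mathcal{A}_k$ is strongly graded if $\mathcal{A}_k\mathcal{A}_l=\mathcal{A}_{k+l}$ for all $k,l$ (linear span of products). $\mathbb{Z}$-gradings correspond to circle actions, and "circle principal bundle over" the space with coordinate algebra $\mathcal{A}_0$ means precisely that the $\mathbb{Z}$-grading of the coordinate algebra $\mathcal{A}$ is strong with degree-zero part $\mathcal{A}_0$. *)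

theory Defs
  imports
    "HOL-Algebra.Algebra"
    "HOL-Algebra.Algebraic_Closure_Type"
    "HOL-Library.Poly_Mapping"
    Complex_Main
begin

abbreviation complex_ring :: "complex ring"
  where "complex_ring \<equiv> ring_of_type_algebra"

text \<open>The locale \<^locale>\<open>algebra\<close> of the library only covers commutative algebras.\<close>

locale complex_algebra = ring A + module complex_ring A
  for A :: "(complex, 'a, 'm) module_scheme" (structure) +
  assumes smult_mult_left:
      "\<lbrakk>x \<in> carrier A; y \<in> carrier A\<rbrakk> \<Longrightarrow> (c \<odot> x) \<otimes> y = c \<odot> (x \<otimes> y)"
    and smult_mult_right:
      "\<lbrakk>x \<in> carrier A; y \<in> carrier A\<rbrakk> \<Longrightarrow> x \<otimes> (c \<odot> y) = c \<odot> (x \<otimes> y)"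

record 'a star_alg = "(complex, 'a) module" +
  adj :: "'a \<Rightarrow> 'a"

locale complex_star_algebra = complex_algebra A
  for A :: "('a, 'm) star_alg_scheme" (structure) +
  assumes adj_closed: "x \<in> carrier A \<Longrightarrow> adj A x \<in> carrier A"
    and adj_adj: "x \<in> carrier A \<Longrightarrow> adj A (adj A x) = x"
    and adj_add: "\<lbrakk>x \<in> carrier A; y \<in> carrier A\<rbrakk> \<Longrightarrow> adj A (x \<oplus> y) = adj A x \<oplus> adj A y"
    and adj_smult: "x \<in> carrier A \<Longrightarrow> adj A (c \<odot> x) = cnj c \<odot> adj A x"
    and adj_mult: "\<lbrakk>x \<in> carrier A; y \<in> carrier A\<rbrakk> \<Longrightarrow> adj A (x \<otimes> y) = adj A y \<otimes> adj A x"

definition linear_span :: "(complex, 'a, 'm) module_scheme \<Rightarrow> 'a set \<Rightarrow> 'a set"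
  where "linear_span A S = \<Inter>{U. submodule U complex_ring A \<and> S \<subseteq> U}"

locale graded_algebra = complex_algebra A
  for A :: "(complex, 'a, 'm) module_scheme" (structure)
    and \<A> :: "int \<Rightarrow> 'a set" +
  assumes component_submodule: "submodule (\<A> k) complex_ring A"
    and component_mult: "\<lbrakk>x \<in> \<A> k; y \<in> \<A> l\<rbrakk> \<Longrightarrow> x \<otimes> y \<in> \<A> (k + l)"
    and direct_sum: "x \<in> carrier A \<Longrightarrow>
      \<exists>!f. (\<forall>k. f k \<in> \<A> k) \<and> finite {k. f k \<noteq> \<zero>} \<and> x = (\<Oplus>k\<in>{k. f k \<noteq> \<zero>}. f k)"

locale strongly_graded_algebra = graded_algebra A \<A>
  for A :: "(complex, 'a, 'm) module_scheme" (structure) and \<A> +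
  assumes strong: "linear_span A {x \<otimes> y | x y. x \<in> \<A> k \<and> y \<in> \<A> l} = \<A> (k + l)"

definition degree_zero_part ::
    "(complex, 'a, 'm) module_scheme \<Rightarrow> (int \<Rightarrow> 'a set) \<Rightarrow> (complex, 'a, 'm) module_scheme"
  where "degree_zero_part A \<A> = A\<lparr>carrier := \<A> 0\<rparr>"

definition circle_principal_bundle ::
    "(complex, 'a, 'm) module_scheme \<Rightarrow> (int \<Rightarrow> 'a set) \<Rightarrow> (complex, 'a, 'm) module_scheme \<Rightarrow> bool"
  where "circle_principal_bundle A \<A> B \<longleftrightarrow>
    strongly_graded_algebra A \<A> \<and> degree_zero_part A \<A> = B"

text \<open>The sum of the components of degree divisible by \<open>N\<close>, regraded by \<open>deg / N\<close>.\<close>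

definition veronese ::
    "(complex, 'a, 'm) module_scheme \<Rightarrow> (int \<Rightarrow> 'a set) \<Rightarrow> nat \<Rightarrow> (complex, 'a, 'm) module_scheme"
  where "veronese A \<A> N = A\<lparr>carrier := linear_span A (\<Union>k \<in> {k. int N dvd k}. \<A> k)\<rparr>"

definition veronese_grading :: "(int \<Rightarrow> 'a set) \<Rightarrow> nat \<Rightarrow> int \<Rightarrow> 'a set"
  where "veronese_grading \<A> N k = \<A> (k * int N)"

text \<open>
  The free $*$-algebra on a set \<open>G\<close> of generators has as its basis the words in the letters
  \<open>Gen x\<close> and \<open>Adj x\<close> (standing for the adjoint of \<open>x\<close>) with \<open>x \<in> G\<close>. Words form a
  monoid, written additively so that \<open>'g word \<Rightarrow>\<^sub>0 complex\<close> carries the convolution product.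
\<close>

datatype 'g letter = Gen 'g | Adj 'g

datatype 'g word = Word (letters: "'g letter list")

instantiation word :: (type) monoid_add
begin

definition zero_word :: "'a word" where "0 = Word []"

definition plus_word :: "'a word \<Rightarrow> 'a word \<Rightarrow> 'a word"
  where "v + w = Word (letters v @ letters w)"

instance
  by standard (auto simp: zero_word_def plus_word_def)

end

type_synonym 'g free_star = "'g word \<Rightarrow>\<^sub>0 complex"

fun letter_base :: "'g letter \<Rightarrow> 'g" where
  "letter_base (Gen x) = x"
| "letter_base (Adj x) = x"

fun letter_adj :: "'g letter \<Rightarrow> 'g letter" where
  "letter_adj (Gen x) = Adj x"
| "letter_adj (Adj x) = Gen x"

fun letter_degree :: "('g \<Rightarrow> int) \<Rightarrow> 'g letter \<Rightarrow> int" where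
  "letter_degree d (Gen x) = d x"
| "letter_degree d (Adj x) = - d x"

definition word_adj :: "'g word \<Rightarrow> 'g word"
  where "word_adj v = Word (rev (map letter_adj (letters v)))"

definition word_degree :: "('g \<Rightarrow> int) \<Rightarrow> 'g word \<Rightarrow> int"
  where "word_degree d v = (\<Sum>a\<leftarrow>letters v. letter_degree d a)"

definition free_gen :: "'g \<Rightarrow> 'g free_star"
  where "free_gen x = Poly_Mapping.single (Word [Gen x]) 1"

definition free_scale :: "complex \<Rightarrow> 'g free_star \<Rightarrow> 'g free_star"
  where "free_scale c p = Poly_Mapping.single 0 c * p"

definition free_adj :: "'g free_star \<Rightarrow> 'g free_star"
  where "free_adj p =
    (\<Sum>v\<in>Poly_Mapping.keys p. Poly_Mapping.single (word_adj v) (cnj (Poly_Mapping.lookup p v)))"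

definition free_star_algebra :: "'g set \<Rightarrow> 'g free_star star_alg"
  where "free_star_algebra G =
    \<lparr>carrier = {p. \<forall>v\<in>Poly_Mapping.keys p. letter_base ` set (letters v) \<subseteq> G},
     monoid.mult = (*), one = 1, ring.zero = 0, add = (+), module.smult = free_scale, adj = free_adj\<rparr>"

definition relation_ideal :: "'g set \<Rightarrow> 'g free_star set \<Rightarrow> 'g free_star set"
  where "relation_ideal G R = Idl\<^bsub>free_star_algebra G\<^esub> (R \<union> free_adj ` R)"

text \<open>
  The quotient by the $*$-ideal generated by \<open>R\<close>; its elements are cosets, and the operations are
  the induced ones. The \<open>carrier\<close> of the free algebra must contain \<open>R\<close>.
\<close>

definition presented_star_algebra :: "'g set \<Rightarrow> 'g free_star set \<Rightarrow> 'g free_star set star_alg"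
  where "presented_star_algebra G R =
    (let F = free_star_algebra G; I = relation_ideal G R; Q = F Quot I in
     \<lparr>carrier = carrier Q, monoid.mult = monoid.mult Q, one = one Q,
      ring.zero = ring.zero Q, add = add Q,
      module.smult = (\<lambda>c U. \<Union>p\<in>U. I +>\<^bsub>F\<^esub> free_scale c p),
      adj = (\<lambda>U. \<Union>p\<in>U. I +>\<^bsub>F\<^esub> free_adj p)\<rparr>)"

definition presented_component ::
    "'g set \<Rightarrow> 'g free_star set \<Rightarrow> ('g \<Rightarrow> int) \<Rightarrow> int \<Rightarrow> 'g free_star set set"
  where "presented_component G R d k =
    {relation_ideal G R +>\<^bsub>free_star_algebra G\<^esub> p | p.
       p \<in> carrier (free_star_algebra G) \<and> (\<forall>v\<in>Poly_Mapping.keys p. word_degree d v = k)}"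

datatype gen = Gen_z nat | Gen_w

abbreviation z_gen :: "nat \<Rightarrow> gen free_star" where "z_gen i \<equiv> free_gen (Gen_z i)"
abbreviation zs_gen :: "nat \<Rightarrow> gen free_star" where "zs_gen i \<equiv> free_adj (z_gen i)"
abbreviation w_gen :: "gen free_star" where "w_gen \<equiv> free_gen Gen_w"
abbreviation ws_gen :: "gen free_star" where "ws_gen \<equiv> free_adj w_gen"

text \<open>An element \<open>a - b\<close> of the following sets encodes the relation \<open>a = b\<close>.\<close>

definition sphere_relations :: "real \<Rightarrow> nat \<Rightarrow> gen free_star set"
  where "sphere_relations q n =
    {z_gen i * z_gen j - free_scale q (z_gen j * z_gen i) | i j. i < j \<and> j \<le> n} \<union>
    {z_gen i * zs_gen j - free_scale q (zs_gen j * z_gen i) | i j. i \<le> n \<and> j \<le> n \<and> i \<noteq> j} \<union>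
    {z_gen i * zs_gen i -
       (zs_gen i * z_gen i + free_scale (q powi (-2) - 1) (\<Sum>j=i+1..n. z_gen j * zs_gen j))
     | i. i \<le> n} \<union>
    {(\<Sum>j=0..n. z_gen j * zs_gen j) - 1}"

text \<open>Centrality of \<open>w_gen\<close> is imposed against the generators and their adjoints.\<close>

definition sigma_relations :: "real \<Rightarrow> nat \<Rightarrow> gen free_star set"
  where "sigma_relations q n =
    sphere_relations q n \<union>
    {w_gen * z_gen i - z_gen i * w_gen | i. i \<le> n} \<union>
    {w_gen * zs_gen i - zs_gen i * w_gen | i. i \<le> n} \<union>
    {w_gen * ws_gen - 1, ws_gen * w_gen - 1} \<union>
    {zs_gen n - w_gen * z_gen n}"

fun gen_degree :: "nat \<Rightarrow> (nat \<Rightarrow> nat) \<Rightarrow> gen \<Rightarrow> int" where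
  "gen_degree n m (Gen_z i) = int (m i)"
| "gen_degree n m Gen_w = - 2 * int (m n)"

definition sphere_gens :: "nat \<Rightarrow> gen set" where "sphere_gens n = Gen_z ` {0..n}"
definition sigma_gens :: "nat \<Rightarrow> gen set" where "sigma_gens n = insert Gen_w (Gen_z ` {0..n})"

definition sphere_algebra :: "real \<Rightarrow> nat \<Rightarrow> gen free_star set star_alg"
  where "sphere_algebra q n = presented_star_algebra (sphere_gens n) (sphere_relations q n)"

definition sphere_grading :: "real \<Rightarrow> nat \<Rightarrow> (nat \<Rightarrow> nat) \<Rightarrow> int \<Rightarrow> gen free_star set set"
  where "sphere_grading q n m =
    presented_component (sphere_gens n) (sphere_relations q n) (gen_degree n m)"

definition sigma_algebra :: "real \<Rightarrow> nat \<Rightarrow> gen free_star set star_alg"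
  where "sigma_algebra q n = presented_star_algebra (sigma_gens n) (sigma_relations q n)"

definition sigma_grading :: "real \<Rightarrow> nat \<Rightarrow> (nat \<Rightarrow> nat) \<Rightarrow> int \<Rightarrow> gen free_star set set"
  where "sigma_grading q n m =
    presented_component (sigma_gens n) (sigma_relations q n) (gen_degree n m)"

definition WP_algebra :: "real \<Rightarrow> nat \<Rightarrow> (nat \<Rightarrow> nat) \<Rightarrow> gen free_star set star_alg"
  where "WP_algebra q n m = degree_zero_part (sphere_algebra q n) (sphere_grading q n m)"

definition RP_algebra :: "real \<Rightarrow> nat \<Rightarrow> (nat \<Rightarrow> nat) \<Rightarrow> gen free_star set star_alg"
  where "RP_algebra q n m = degree_zero_part (sigma_algebra q n) (sigma_grading q n m)"

definition lens_algebra :: "real \<Rightarrow> nat \<Rightarrow> nat \<Rightarrow> (nat \<Rightarrow> nat) \<Rightarrow> gen free_star set star_alg"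
  where "lens_algebra q n N m = veronese (sphere_algebra q n) (sphere_grading q n m) N"

definition lens_grading :: "real \<Rightarrow> nat \<Rightarrow> nat \<Rightarrow> (nat \<Rightarrow> nat) \<Rightarrow> int \<Rightarrow> gen free_star set set"
  where "lens_grading q n N m = veronese_grading (sphere_grading q n m) N"

definition sigma_lens_algebra :: "real \<Rightarrow> nat \<Rightarrow> nat \<Rightarrow> (nat \<Rightarrow> nat) \<Rightarrow> gen free_star set star_alg"
  where "sigma_lens_algebra q n N m = veronese (sigma_algebra q n) (sigma_grading q n m) N"

definition sigma_lens_grading :: "real \<Rightarrow> nat \<Rightarrow> nat \<Rightarrow> (nat \<Rightarrow> nat) \<Rightarrow> int \<Rightarrow> gen free_star set set"
  where "sigma_lens_grading q n N m = veronese_grading (sigma_grading q n m) N"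

end

theory Submission
  imports Defs
begin

text \<open>
  Write $y_i = \sum_{j \ge i} z_j z_j^*$, so that $y_0 = 1$ and $y_{n+1} = 0$. Since $z_i$ commutes with
  $y_i$ and $q^2$-commutes with $y_{i+1}$, both $z_i^l z_i^{*l}$ and $z_i^{*l} z_i^l$ have the form
  $y_i^l + y_{i+1} r$, where $r$ has degree zero and commutes with $y_{i+1}$. If $M$ is a multiple of
  $\prod_i m_i$, then $l$ can be chosen such that $z_i^l$ or $z_i^{*l}$ has degree $M$. Hence in the
  degree-zero part, modulo the two-sided ideal $\mathcal{A}_M \mathcal{A}_{-M}$, the nilpotency of $y_{i+1}$
  implies that of $y_i$. Descending from $y_{n+1} = 0$ to $y_0 = 1$ gives
  $1 \in \mathcal{A}_M \mathcal{A}_{-M}$; that this holds for all such $M$ means that the grading is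
  strong. Besides these relations, only their homogeneity matters, so spheres and their
  $\Sigma$-variants are treated alike.
\<close>

section \<open>The free star-algebra and its quotients\<close>

text \<open>The obstacle in the descent is noncommutativity. In degree zero, y_i^l = p - y_{i+1} r
  with p in the product ideal, but knowing only that some power of y_{i+1} lies in that ideal would
  not control the powers of y_{i+1} r. Because r commutes with y_{i+1}, these powers split as
  y_{i+1}^k times a power of r. For this reason the expansion of z_i^l zs_i^l (with zs_i for the
  adjoint of z_i) carries the commutation of r through its induction, along with its degree.

  The two orders of the factors differ only in two constants: the coefficient of y_{i+1} in the
  product, and the scalar picked up when the first factor crosses y_{i+1}. They are -1 and q^2 for
  z_i zs_i, but -q^(-2) and q^(-2) for zs_i z_i. One criterion with these as parameters thus covers
  degrees of both signs.

  The other difficulty lies in the presentation: components of a quotient span it, but their sum is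
  direct only if the ideal contains the homogeneous parts of all its elements. This is what
  homogeneity of the relations provides.\<close>

lemma letter_adj_adj [simp]: "letter_adj (letter_adj a) = a"
  by (cases a) auto

lemma letter_base_adj [simp]: "letter_base (letter_adj a) = letter_base a"
  by (cases a) auto

lemma letter_degree_adj [simp]: "letter_degree d (letter_adj a) = - letter_degree d a"
  by (cases a) auto

lemma word_adj_adj [simp]: "word_adj (word_adj v) = v"
  by (cases v) (simp add: word_adj_def rev_map comp_def)

lemma word_adj_add: "word_adj (v + w) = word_adj w + word_adj v"
  by (simp add: word_adj_def plus_word_def)

lemma letters_add [simp]: "letters (v + w) = letters v @ letters w"
  by (simp add: plus_word_def)

lemma word_degree_add: "word_degree d (v + w) = word_degree d v + word_degree d w"
  by (simp add: word_degree_def)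

lemma letters_0 [simp]: "letters 0 = []"
  by (simp add: zero_word_def)

lemma word_degree_0 [simp]: "word_degree d 0 = 0"
  by (simp add: word_degree_def)

lemma word_degree_adj [simp]: "word_degree d (word_adj v) = - word_degree d v"
proof -
  have "(\<Sum>a\<leftarrow>xs. - letter_degree d a) = - (\<Sum>a\<leftarrow>xs. letter_degree d a)" for xs
    by (induction xs) auto
  then show ?thesis
    by (simp add: word_degree_def word_adj_def rev_map[symmetric] comp_def sum_list_rev)
qed

lemma letter_base_word_adj [simp]:
  "letter_base ` set (letters (word_adj v)) = letter_base ` set (letters v)"
  by (simp add: word_adj_def image_image)

text \<open>As \<open>word_adj\<close> is an involution, a single word contributes to the
  coefficient at \<open>v\<close>. Most identities for \<open>free_adj\<close> can then be checked
  coefficientwise.\<close>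

lemma lookup_free_adj:
  "Poly_Mapping.lookup (free_adj p) v = cnj (Poly_Mapping.lookup p (word_adj v))"
proof -
  have "Poly_Mapping.lookup (free_adj p) v =
      (\<Sum>w\<in>Poly_Mapping.keys p. if w = word_adj v then cnj (Poly_Mapping.lookup p w) else 0)"
    unfolding free_adj_def lookup_sum
    by (intro sum.cong refl) (auto simp: lookup_single when_def)
  also have "\<dots> = cnj (Poly_Mapping.lookup p (word_adj v))"
    by (simp add: in_keys_iff)
  finally show ?thesis .
qed

lemma free_adj_adj [simp]: "free_adj (free_adj p) = p"
  by (rule poly_mapping_eqI) (simp add: lookup_free_adj)

lemma free_adj_add: "free_adj (p + r) = free_adj p + free_adj r"
  by (rule poly_mapping_eqI) (simp add: lookup_free_adj lookup_add)

lemma free_adj_0 [simp]: "free_adj 0 = 0"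
  by (rule poly_mapping_eqI) (simp add: lookup_free_adj)

lemma free_adj_uminus: "free_adj (- p) = - free_adj p"
  by (rule poly_mapping_eqI) (simp add: lookup_free_adj)

lemma free_adj_single: "free_adj (Poly_Mapping.single v c) = Poly_Mapping.single (word_adj v) (cnj c)"
  by (rule poly_mapping_eqI) (auto simp: lookup_free_adj lookup_single when_def)

text \<open>Every finitely supported function is a finite sum of monomials, so identities that are
  additive in each argument need checking on monomials only.\<close>

lemma poly_mapping_add_induct [case_names zero single add]:
  fixes p :: "'a \<Rightarrow>\<^sub>0 'b::comm_monoid_add"
  assumes "P 0" and "\<And>v c. P (Poly_Mapping.single v c)" and "\<And>p r. P p \<Longrightarrow> P r \<Longrightarrow> P (p + r)"
  shows "P p"
proof (induction p rule: update_induct)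
  case const
  show ?case by (fact assms)
next
  case (update p a b)
  \<comment> \<open>The key \<open>a\<close> is new, so setting its coefficient amounts to adding a
    monomial.\<close>
  have "Poly_Mapping.update a b p = p + Poly_Mapping.single a b"
    using update(1)
    by (intro poly_mapping_eqI) (auto simp: lookup_update lookup_add lookup_single in_keys_iff)
  then show ?case
    using update assms by simp
qed

text \<open>Both sides are biadditive; on two words the claim is \<open>word_adj_add\<close>, the
  reversal of a concatenation.\<close>

lemma free_adj_mult: "free_adj (p * r) = free_adj r * free_adj p"
proof (induction p rule: poly_mapping_add_induct)
  case (single v c)
  show ?case
    by (induction r rule: poly_mapping_add_induct)
      (simp_all add: free_adj_single mult_single word_adj_add free_adj_add algebra_simps)
qed (simp_all add: free_adj_add algebra_simps)

lemma lookup_free_scale: "Poly_Mapping.lookup (free_scale c p) v = c * Poly_Mapping.lookup p v"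
  unfolding free_scale_def mult_map_scale_conv_mult[symmetric]
  by (simp add: Poly_Mapping.map.rep_eq when_def)

lemma free_adj_scale: "free_adj (free_scale c p) = free_scale (cnj c) (free_adj p)"
  by (rule poly_mapping_eqI) (simp add: lookup_free_adj lookup_free_scale)

lemma free_scale_mult_left: "free_scale c p * r = free_scale c (p * r)"
  by (simp add: free_scale_def mult.assoc)

text \<open>Scalars sit at the empty word, which is neutral for concatenation, so they are
  central.\<close>

lemma free_scale_mult_right: "p * free_scale c r = free_scale c (p * r)"
proof -
  have "p * Poly_Mapping.single 0 c = Poly_Mapping.single 0 c * p"
    by (induction p rule: poly_mapping_add_induct) (auto simp: mult_single algebra_simps)
  then show ?thesis
    by (simp add: free_scale_def mult.assoc[symmetric])
qed

lemma free_scale_distrib_left: "free_scale (c + c') p = free_scale c p + free_scale c' p"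
  by (rule poly_mapping_eqI) (simp add: lookup_free_scale lookup_add algebra_simps)

lemma free_scale_distrib_right: "free_scale c (p + r) = free_scale c p + free_scale c r"
  by (rule poly_mapping_eqI) (simp add: lookup_free_scale lookup_add algebra_simps)

lemma free_scale_scale: "free_scale c (free_scale c' p) = free_scale (c * c') p"
  by (rule poly_mapping_eqI) (simp add: lookup_free_scale)

lemma free_scale_one [simp]: "free_scale 1 p = p"
  by (rule poly_mapping_eqI) (simp add: lookup_free_scale)

section \<open>Homogeneous parts of noncommutative polynomials\<close>

definition homogeneous_part :: "('g \<Rightarrow> int) \<Rightarrow> int \<Rightarrow> 'g free_star \<Rightarrow> 'g free_star"
  where "homogeneous_part d k p =
    (\<Sum>v\<in>{v \<in> Poly_Mapping.keys p. word_degree d v = k}. Poly_Mapping.single v (Poly_Mapping.lookup p v))"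

lemma lookup_homogeneous_part:
  "Poly_Mapping.lookup (homogeneous_part d k p) v =
    (if word_degree d v = k then Poly_Mapping.lookup p v else 0)"
proof -
  have "Poly_Mapping.lookup (homogeneous_part d k p) v =
      (\<Sum>w\<in>{w \<in> Poly_Mapping.keys p. word_degree d w = k}. if w = v then Poly_Mapping.lookup p w else 0)"
    unfolding homogeneous_part_def lookup_sum
    by (intro sum.cong refl) (auto simp: lookup_single when_def)
  then show ?thesis
    by (simp add: in_keys_iff)
qed

lemma homogeneous_part_add:
  "homogeneous_part d k (p + r) = homogeneous_part d k p + homogeneous_part d k r"
  by (rule poly_mapping_eqI) (simp add: lookup_homogeneous_part lookup_add)

lemma homogeneous_part_uminus: "homogeneous_part d k (- p) = - homogeneous_part d k p"
  by (rule poly_mapping_eqI) (simp add: lookup_homogeneous_part)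

lemma homogeneous_part_0 [simp]: "homogeneous_part d k 0 = 0"
  by (rule poly_mapping_eqI) (simp add: lookup_homogeneous_part)

lemma homogeneous_part_sum:
  "homogeneous_part d k (\<Sum>i\<in>S. f i) = (\<Sum>i\<in>S. homogeneous_part d k (f i))"
  by (induction S rule: infinite_finite_induct) (simp_all add: homogeneous_part_add)

lemma homogeneous_part_single:
  "homogeneous_part d k (Poly_Mapping.single v c) =
    (if word_degree d v = k then Poly_Mapping.single v c else 0)"
  by (rule poly_mapping_eqI) (auto simp: lookup_homogeneous_part lookup_single when_def)

text \<open>A word shifts all degrees by a fixed amount, while a general factor mixes degrees. Hence
  ideals are tested against monomials in \<open>relation_ideal_homogeneous_part\<close>.\<close>

lemma homogeneous_part_single_mult:
  "homogeneous_part d k (Poly_Mapping.single v c * p) =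
    Poly_Mapping.single v c * homogeneous_part d (k - word_degree d v) p"
  by (induction p rule: poly_mapping_add_induct)
    (auto simp: homogeneous_part_add homogeneous_part_single mult_single word_degree_add algebra_simps)

lemma homogeneous_part_mult_single:
  "homogeneous_part d k (p * Poly_Mapping.single v c) =
    homogeneous_part d (k - word_degree d v) p * Poly_Mapping.single v c"
  by (induction p rule: poly_mapping_add_induct)
    (auto simp: homogeneous_part_add homogeneous_part_single mult_single word_degree_add algebra_simps)

lemma sum_homogeneous_parts:
  assumes "finite S" and "word_degree d ` Poly_Mapping.keys p \<subseteq> S"
  shows "(\<Sum>k\<in>S. homogeneous_part d k p) = p"
proof (rule poly_mapping_eqI)
  fix v
  have "Poly_Mapping.lookup p v = 0" if "word_degree d v \<notin> S"
    using that assms(2) by (meson image_subset_iff in_keys_iff)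
  then show "Poly_Mapping.lookup (\<Sum>k\<in>S. homogeneous_part d k p) v = Poly_Mapping.lookup p v"
    using assms(1) by (auto simp: lookup_sum lookup_homogeneous_part)
qed

section \<open>Homogeneous components of the free algebra\<close>

definition free_component :: "'g set \<Rightarrow> ('g \<Rightarrow> int) \<Rightarrow> int \<Rightarrow> 'g free_star set"
  where "free_component G d k = {p \<in> carrier (free_star_algebra G).
    \<forall>v\<in>Poly_Mapping.keys p. word_degree d v = k}"

lemma free_componentI_lookup:
  assumes "\<And>v. Poly_Mapping.lookup p v \<noteq> 0 \<Longrightarrow>
    word_degree d v = k \<and> letter_base ` set (letters v) \<subseteq> G"
  shows "p \<in> free_component G d k"
  using assms by (auto simp: free_component_def free_star_algebra_def in_keys_iff subset_iff)

lemma free_componentD_lookup: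
  assumes "p \<in> free_component G d k" "Poly_Mapping.lookup p v \<noteq> 0"
  shows "word_degree d v = k \<and> letter_base ` set (letters v) \<subseteq> G"
  using assms by (auto simp: free_component_def free_star_algebra_def in_keys_iff subset_iff)

lemma free_component_0 [simp]: "0 \<in> free_component G d k"
  by (rule free_componentI_lookup) auto

lemma free_component_add:
  "p \<in> free_component G d k \<Longrightarrow> r \<in> free_component G d k \<Longrightarrow> p + r \<in> free_component G d k"
  by (rule free_componentI_lookup) (metis add_0 free_componentD_lookup lookup_add)

lemma free_component_uminus: "p \<in> free_component G d k \<Longrightarrow> - p \<in> free_component G d k"
  by (rule free_componentI_lookup) (metis free_componentD_lookup lookup_uminus neg_0_equal_iff_equal)

lemma free_component_diff:
  "p \<in> free_component G d k \<Longrightarrow> r \<in> free_component G d k \<Longrightarrow> p - r \<in> free_component G d k"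
  by (metis diff_conv_add_uminus free_component_add free_component_uminus)

lemma free_component_sum:
  "(\<And>i. i \<in> S \<Longrightarrow> f i \<in> free_component G d k) \<Longrightarrow> (\<Sum>i\<in>S. f i) \<in> free_component G d k"
  by (induction S rule: infinite_finite_induct) (auto intro: free_component_add)

lemma free_component_scale: "p \<in> free_component G d k \<Longrightarrow> free_scale c p \<in> free_component G d k"
  by (rule free_componentI_lookup) (metis free_componentD_lookup lookup_free_scale mult_zero_right)

lemma free_component_adj: "p \<in> free_component G d k \<Longrightarrow> free_adj p \<in> free_component G d (- k)"
proof (rule free_componentI_lookup)
  fix v
  assume "p \<in> free_component G d k" "Poly_Mapping.lookup (free_adj p) v \<noteq> 0"
  then show "word_degree d v = - k \<and> letter_base ` set (letters v) \<subseteq> G"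
    using free_componentD_lookup[of p G d k "word_adj v"] by (auto simp: lookup_free_adj)
qed

lemma free_component_mult:
  assumes "p \<in> free_component G d k" "r \<in> free_component G d l"
  shows "p * r \<in> free_component G d (k + l)"
  using assms keys_mult[of p r]
  by (fastforce simp: free_component_def free_star_algebra_def word_degree_add)

lemma free_component_one: "1 \<in> free_component G d 0"
  by (auto simp: free_component_def free_star_algebra_def)

lemma free_component_gen: "x \<in> G \<Longrightarrow> free_gen x \<in> free_component G d (d x)"
  by (auto simp: free_component_def free_star_algebra_def free_gen_def word_degree_def)

lemma homogeneous_part_in_component:
  "p \<in> carrier (free_star_algebra G) \<Longrightarrow> homogeneous_part d k p \<in> free_component G d k"
  by (rule free_componentI_lookup)
    (auto simp: lookup_homogeneous_part free_star_algebra_def in_keys_iff subset_iff split: if_splits)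

lemma homogeneous_part_component:
  "p \<in> free_component G d l \<Longrightarrow> homogeneous_part d k p = (if k = l then p else 0)"
  by (rule poly_mapping_eqI)
    (auto simp: lookup_homogeneous_part dest: free_componentD_lookup)

lemma free_component_subset: "free_component G d k \<subseteq> carrier (free_star_algebra G)"
  by (auto simp: free_component_def)

lemma free_star_algebra_simps [simp]:
  "monoid.mult (free_star_algebra G) = (*)" "one (free_star_algebra G) = 1"
  "ring.zero (free_star_algebra G) = 0" "add (free_star_algebra G) = (+)"
  "module.smult (free_star_algebra G) = free_scale" "adj (free_star_algebra G) = free_adj"
  by (simp_all add: free_star_algebra_def)

text \<open>For the constantly zero degree function every word has degree 0. The closure properties
  of the carrier thereby become instances of those of \<open>free_component\<close>.\<close>

lemma carrier_free_star_algebra: "carrier (free_star_algebra G) = free_component G (\<lambda>_. 0) 0"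
proof -
  have "word_degree (\<lambda>_. 0) v = 0" for v :: "'a word"
  proof -
    have "letter_degree (\<lambda>_. 0) a = 0" for a :: "'a letter"
      by (cases a) auto
    then show ?thesis
      by (simp add: word_degree_def)
  qed
  then show ?thesis
    by (auto simp: free_component_def)
qed

lemma free_carrier_closed:
  "p \<in> carrier (free_star_algebra G) \<Longrightarrow> r \<in> carrier (free_star_algebra G) \<Longrightarrow>
    p + r \<in> carrier (free_star_algebra G)"
  "p \<in> carrier (free_star_algebra G) \<Longrightarrow> r \<in> carrier (free_star_algebra G) \<Longrightarrow>
    p * r \<in> carrier (free_star_algebra G)"
  "p \<in> carrier (free_star_algebra G) \<Longrightarrow> r \<in> carrier (free_star_algebra G) \<Longrightarrow>
    p - r \<in> carrier (free_star_algebra G)"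
  "p \<in> carrier (free_star_algebra G) \<Longrightarrow> - p \<in> carrier (free_star_algebra G)"
  "p \<in> carrier (free_star_algebra G) \<Longrightarrow> free_scale c p \<in> carrier (free_star_algebra G)"
  "p \<in> carrier (free_star_algebra G) \<Longrightarrow> free_adj p \<in> carrier (free_star_algebra G)"
  using free_component_mult[of p G "\<lambda>_. 0" 0 r 0] free_component_adj[of p G "\<lambda>_. 0" 0]
  unfolding carrier_free_star_algebra
  by (simp_all add: free_component_add free_component_uminus free_component_diff free_component_scale)

lemma free_carrier_0_1 [simp]:
  "0 \<in> carrier (free_star_algebra G)" "1 \<in> carrier (free_star_algebra G)"
  unfolding carrier_free_star_algebra by (simp_all add: free_component_one)

lemma ring_free_star_algebra: "ring (free_star_algebra G)"
  by (intro ringI abelian_groupI monoidI)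
    (auto simp: free_carrier_closed algebra_simps intro: bexI[of _ "- _"])

lemma free_star_algebra_a_inv:
  assumes "p \<in> carrier (free_star_algebra G)"
  shows "a_inv (free_star_algebra G) p = - p"
proof -
  interpret ring "free_star_algebra G"
    by (rule ring_free_star_algebra)
  show ?thesis
    by (rule minus_equality) (use assms in \<open>simp_all add: free_carrier_closed\<close>)
qed

lemma free_star_algebra_minus:
  assumes "p \<in> carrier (free_star_algebra G)" "r \<in> carrier (free_star_algebra G)"
  shows "p \<ominus>\<^bsub>free_star_algebra G\<^esub> r = p - r"
  using assms by (simp add: a_minus_def free_star_algebra_a_inv)

lemma free_idealI:
  assumes "J \<subseteq> carrier (free_star_algebra G)" and "0 \<in> J"
    and "\<And>p r. p \<in> J \<Longrightarrow> r \<in> J \<Longrightarrow> p + r \<in> J" and "\<And>p. p \<in> J \<Longrightarrow> - p \<in> J"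
    and "\<And>p r. p \<in> carrier (free_star_algebra G) \<Longrightarrow> r \<in> J \<Longrightarrow> p * r \<in> J"
    and "\<And>p r. p \<in> carrier (free_star_algebra G) \<Longrightarrow> r \<in> J \<Longrightarrow> r * p \<in> J"
  shows "ideal J (free_star_algebra G)"
proof (rule idealI[OF ring_free_star_algebra])
  interpret ring "free_star_algebra G"
    by (rule ring_free_star_algebra)
  show "subgroup J (add_monoid (free_star_algebra G))"
    by (rule add.subgroupI)
      (use assms free_star_algebra_a_inv[of _ G] in \<open>auto simp: subset_iff simp flip: a_inv_def\<close>)
qed (use assms in auto)

lemma complex_ring_simps:
  "carrier complex_ring = UNIV" "monoid.mult complex_ring = (*)" "one complex_ring = 1"
  "ring.zero complex_ring = 0" "add complex_ring = (+)"
  by (simp_all add: ring_of_type_algebra_def)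

text \<open>\<open>graded_algebra\<close> sums over the exact support of a family, whereas
  constructions yield a finite set that merely contains it.\<close>

lemma (in abelian_monoid) finsum_support:
  assumes "finite S" and "{k. f k \<noteq> \<zero>} \<subseteq> S" and "\<And>k. k \<in> S \<Longrightarrow> f k \<in> carrier G"
  shows "(\<Oplus>k\<in>S. f k) = (\<Oplus>k\<in>{k. f k \<noteq> \<zero>}. f k)"
  by (rule add.finprod_mono_neutral_cong_right) (use assms in auto)

section \<open>Quotients by homogeneous relations\<close>

locale star_presentation =
  fixes G :: "'g set" and R :: "'g free_star set" and d :: "'g \<Rightarrow> int"
  assumes relations_homogeneous: "r \<in> R \<Longrightarrow> \<exists>k. r \<in> free_component G d k"
begin

abbreviation "F \<equiv> free_star_algebra G"
abbreviation "I \<equiv> relation_ideal G R"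
abbreviation "Q \<equiv> presented_star_algebra G R"
abbreviation "cls p \<equiv> I +>\<^bsub>F\<^esub> p"

lemma relations_subset: "R \<union> free_adj ` R \<subseteq> carrier F"
  using relations_homogeneous free_component_subset by (fastforce simp: free_carrier_closed)

lemma relation_ideal_ideal: "ideal I F"
  unfolding relation_ideal_def
  by (rule ring.genideal_ideal[OF ring_free_star_algebra relations_subset])

sublocale F: ring F
  by (rule ring_free_star_algebra)

sublocale I: ideal I F
  by (rule relation_ideal_ideal)

lemma relation_ideal_subset: "I \<subseteq> carrier F"
  using I.a_subset by simp

lemma relation_in_ideal: "r \<in> R \<Longrightarrow> r \<in> I"
  unfolding relation_ideal_def using F.genideal_self[OF relations_subset] by auto

lemma relation_ideal_minimal: "ideal J F \<Longrightarrow> R \<union> free_adj ` R \<subseteq> J \<Longrightarrow> I \<subseteq> J"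
  unfolding relation_ideal_def by (rule F.genideal_minimal)

lemma relation_ideal_closed:
  "0 \<in> I"
  "p \<in> I \<Longrightarrow> r \<in> I \<Longrightarrow> p + r \<in> I"
  "p \<in> I \<Longrightarrow> - p \<in> I"
  "p \<in> carrier F \<Longrightarrow> r \<in> I \<Longrightarrow> p * r \<in> I"
  "p \<in> carrier F \<Longrightarrow> r \<in> I \<Longrightarrow> r * p \<in> I"
  using I.zero_closed I.a_closed[of p r] I.I_l_closed I.I_r_closed I.a_inv_closed[of p]
    relation_ideal_subset free_star_algebra_a_inv[of p G] by auto

lemma relation_ideal_sum: "(\<And>i. i \<in> S \<Longrightarrow> f i \<in> I) \<Longrightarrow> (\<Sum>i\<in>S. f i) \<in> I"
  by (induction S rule: infinite_finite_induct) (auto intro: relation_ideal_closed)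

lemma relation_ideal_scale:
  assumes "p \<in> I"
  shows "free_scale c p \<in> I"
proof -
  have "free_scale c 1 \<in> carrier F"
    by (simp add: free_carrier_closed)
  moreover have "free_scale c p = free_scale c 1 * p"
    by (simp add: free_scale_mult_left)
  ultimately show ?thesis
    using assms by (simp add: relation_ideal_closed)
qed

text \<open>The preimage of \<open>I\<close> under \<open>free_adj\<close> is again an ideal, since
  reversing products exchanges left and right multiples and \<open>I\<close> is two-sided. It
  contains the generators because their set is closed under adjoints.\<close>

lemma relation_ideal_adj:
  assumes "p \<in> I"
  shows "free_adj p \<in> I"
proof -
  let ?J = "{p \<in> carrier F. free_adj p \<in> I}"
  have "ideal ?J F"
    by (rule free_idealI)
      (auto simp: free_adj_add free_adj_mult free_adj_uminus relation_ideal_closed free_carrier_closed)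
  moreover have "R \<union> free_adj ` R \<subseteq> ?J"
    using relations_subset F.genideal_self[OF relations_subset]
    by (auto simp: relation_ideal_def)
  ultimately show ?thesis
    using relation_ideal_minimal assms by blast
qed

lemma carrier_decompose:
  assumes "p \<in> carrier F"
  obtains V c where "finite V" "\<forall>v\<in>V. Poly_Mapping.single v (c v) \<in> carrier F"
    "p = (\<Sum>v\<in>V. Poly_Mapping.single v (c v))"
proof
  show "p = (\<Sum>v\<in>Poly_Mapping.keys p. Poly_Mapping.single v (Poly_Mapping.lookup p v))"
    by (rule poly_mapping_eqI) (auto simp: lookup_sum lookup_single when_def in_keys_iff)
  show "\<forall>v\<in>Poly_Mapping.keys p. Poly_Mapping.single v (Poly_Mapping.lookup p v) \<in> carrier F"
    using assms by (auto simp: free_star_algebra_def)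
qed auto

text \<open>The polynomials all of whose parts lie in \<open>I\<close> form an ideal, and the
  homogeneous generators belong to it. This is the source of unique decompositions in the
  quotient.\<close>

lemma relation_ideal_homogeneous_part:
  assumes "p \<in> I"
  shows "homogeneous_part d k p \<in> I"
proof -
  let ?J = "{p \<in> carrier F. \<forall>k. homogeneous_part d k p \<in> I}"
  have "ideal ?J F"
  proof (rule free_idealI)
    fix p r
    assume p: "p \<in> carrier F" and r: "r \<in> ?J"
    \<comment> \<open>For a monomial factor, a homogeneous part of the product is that factor times
      a single shifted part of \<open>r\<close>.\<close>
    obtain V c where V: "finite V" "\<forall>v\<in>V. Poly_Mapping.single v (c v) \<in> carrier F"
        "p = (\<Sum>v\<in>V. Poly_Mapping.single v (c v))"
      using carrier_decompose[OF p] by blast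
    have "homogeneous_part d k (p * r) \<in> I" "homogeneous_part d k (r * p) \<in> I" for k
    proof -
      show "homogeneous_part d k (p * r) \<in> I"
        unfolding V(3) sum_distrib_right homogeneous_part_sum homogeneous_part_single_mult
        by (rule relation_ideal_sum, rule relation_ideal_closed(4)) (use V(2) r in auto)
      show "homogeneous_part d k (r * p) \<in> I"
        unfolding V(3) sum_distrib_left homogeneous_part_sum homogeneous_part_mult_single
        by (rule relation_ideal_sum, rule relation_ideal_closed(5)) (use V(2) r in auto)
    qed
    then show "p * r \<in> ?J" "r * p \<in> ?J"
      using p r by (auto simp: free_carrier_closed)
  qed (auto simp: homogeneous_part_add homogeneous_part_uminus relation_ideal_closed free_carrier_closed)
  moreover have "R \<union> free_adj ` R \<subseteq> ?J"
  proof -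
    \<comment> \<open>The parts of a homogeneous element are itself and zero.\<close>
    have *: "r \<in> ?J" if "r \<in> free_component G d k" "r \<in> I" for r k
      using that relation_ideal_subset
      by (auto simp: homogeneous_part_component relation_ideal_closed)
    show ?thesis
    proof (intro Un_least image_subsetI subsetI)
      fix r
      assume r: "r \<in> R"
      obtain k where k: "r \<in> free_component G d k"
        using relations_homogeneous[OF r] by blast
      show "r \<in> ?J" "free_adj r \<in> ?J"
        using *[OF k] *[OF free_component_adj[OF k]] relation_in_ideal[OF r] relation_ideal_adj
        by blast+
    qed
  qed
  ultimately show ?thesis
    using relation_ideal_minimal assms by blast
qed

lemma cls_eq_iff:
  "p \<in> carrier F \<Longrightarrow> r \<in> carrier F \<Longrightarrow> cls p = cls r \<longleftrightarrow> p - r \<in> I"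
  using F.quotient_eq_iff_same_a_r_cos[OF relation_ideal_ideal, of p r]
  by (simp add: free_star_algebra_minus)

lemma mem_cls: "x \<in> cls p \<longleftrightarrow> (\<exists>i\<in>I. x = i + p)"
  by (auto simp: a_r_coset_def r_coset_def)

lemma presented_carrier: "carrier Q = cls ` carrier F"
  by (auto simp: presented_star_algebra_def Let_def FactRing_def A_RCOSETS_def RCOSETS_def
      a_r_coset_def)

text \<open>Scaling and adjoint on the quotient are defined as unions over representatives. For an
  additive map that preserves \<open>I\<close>, all members of the nonempty class give the same
  coset, so the union is that coset.\<close>

lemma UN_cls:
  assumes "p \<in> carrier F" and "\<And>r. r \<in> carrier F \<Longrightarrow> f r \<in> carrier F"
    and "\<And>r r'. f (r + r') = f r + f r'" and "\<And>r. r \<in> I \<Longrightarrow> f r \<in> I"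
  shows "(\<Union>r\<in>cls p. cls (f r)) = cls (f p)"
proof -
  have "cls (f r) = cls (f p)" if r: "r \<in> cls p" for r
  proof -
    obtain i where "i \<in> I" "r = i + p"
      using r by (auto simp: mem_cls)
    moreover from this have "i \<in> carrier F"
      using relation_ideal_subset by auto
    ultimately show ?thesis
      using assms by (simp add: cls_eq_iff free_carrier_closed)
  qed
  moreover have "p \<in> cls p"
    by (auto simp: mem_cls intro: bexI[of _ 0] relation_ideal_closed)
  ultimately show ?thesis
    by blast
qed

lemma presented_simps:
  "\<zero>\<^bsub>Q\<^esub> = cls 0" "\<one>\<^bsub>Q\<^esub> = cls 1"
  "p \<in> carrier F \<Longrightarrow> r \<in> carrier F \<Longrightarrow> cls p \<otimes>\<^bsub>Q\<^esub> cls r = cls (p * r)"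
  "p \<in> carrier F \<Longrightarrow> r \<in> carrier F \<Longrightarrow> cls p \<oplus>\<^bsub>Q\<^esub> cls r = cls (p + r)"
  "p \<in> carrier F \<Longrightarrow> c \<odot>\<^bsub>Q\<^esub> cls p = cls (free_scale c p)"
  "p \<in> carrier F \<Longrightarrow> adj Q (cls p) = cls (free_adj p)"
proof -
  show "\<zero>\<^bsub>Q\<^esub> = cls 0"
    by (auto simp: presented_star_algebra_def Let_def FactRing_def mem_cls)
  show "\<one>\<^bsub>Q\<^esub> = cls 1"
    by (simp add: presented_star_algebra_def Let_def FactRing_def)
  show "cls p \<otimes>\<^bsub>Q\<^esub> cls r = cls (p * r)" if "p \<in> carrier F" "r \<in> carrier F"
    using I.rcoset_mult_add[OF that] by (simp add: presented_star_algebra_def Let_def FactRing_def)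
  show "cls p \<oplus>\<^bsub>Q\<^esub> cls r = cls (p + r)" if "p \<in> carrier F" "r \<in> carrier F"
    using I.a_rcos_sum[OF that] by (simp add: presented_star_algebra_def Let_def FactRing_def)
  show "c \<odot>\<^bsub>Q\<^esub> cls p = cls (free_scale c p)" if "p \<in> carrier F"
    using UN_cls[OF that, of "free_scale c"] relation_ideal_scale
    by (simp add: presented_star_algebra_def Let_def free_carrier_closed free_scale_distrib_right)
  show "adj Q (cls p) = cls (free_adj p)" if "p \<in> carrier F"
    using UN_cls[OF that, of free_adj] relation_ideal_adj
    by (simp add: presented_star_algebra_def Let_def free_carrier_closed free_adj_add)
qed

lemma ring_presented: "ring Q"
proof (intro ringI abelian_groupI monoidI)
  fix x
  assume "x \<in> carrier Q"
  then obtain p where p: "p \<in> carrier F" "x = cls p"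
    by (auto simp: presented_carrier)
  then show "\<exists>y\<in>carrier Q. y \<oplus>\<^bsub>Q\<^esub> x = \<zero>\<^bsub>Q\<^esub>"
    by (intro bexI[of _ "cls (- p)"])
      (auto simp: presented_carrier presented_simps free_carrier_closed)
qed (auto simp: presented_carrier presented_simps free_carrier_closed algebra_simps)

lemma complex_algebra_presented: "complex_algebra Q"
proof (intro complex_algebra.intro ring_presented moduleI complex_algebra_axioms.intro
    cring_from_type_algebra)
  show "abelian_group Q"
    using ring_presented by (rule ring.is_abelian_group)
qed (auto simp: complex_ring_simps presented_carrier presented_simps free_carrier_closed
    free_scale_distrib_left free_scale_distrib_right free_scale_scale
    free_scale_mult_left free_scale_mult_right)

lemma complex_star_algebra_presented: "complex_star_algebra Q"
  by (intro complex_star_algebra.intro complex_algebra_presented complex_star_algebra_axioms.intro)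
    (auto simp: presented_carrier presented_simps free_carrier_closed
      free_adj_add free_adj_mult free_adj_scale)

sublocale Q: complex_star_algebra Q
  by (rule complex_star_algebra_presented)

lemma presented_component_eq: "presented_component G R d k = cls ` free_component G d k"
  by (auto simp: presented_component_def free_component_def)

lemma free_componentD: "p \<in> free_component G d k \<Longrightarrow> p \<in> carrier F"
  using free_component_subset by auto

lemma presented_component_carrier: "presented_component G R d k \<subseteq> carrier Q"
  by (auto simp: presented_component_eq presented_carrier free_componentD)

text \<open>Membership of the sum in the carrier is carried along because additivity of
  \<open>cls\<close> requires it in the induction step.\<close>

lemma cls_finsum:
  "(\<And>i. i \<in> S \<Longrightarrow> f i \<in> carrier F) \<Longrightarrow>
    (\<Oplus>\<^bsub>Q\<^esub>i\<in>S. cls (f i)) = cls (\<Sum>i\<in>S. f i) \<and> (\<Sum>i\<in>S. f i) \<in> carrier F"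
proof (induction S rule: infinite_finite_induct)
  case (insert x S)
  then have "(\<lambda>i. cls (f i)) \<in> S \<rightarrow> carrier Q" "cls (f x) \<in> carrier Q"
    by (auto simp: presented_carrier)
  then show ?case
    using insert by (simp add: presented_simps free_carrier_closed)
qed (simp_all add: presented_simps)

text \<open>Existence comes from the parts of any representative, uniqueness from the homogeneity of
  \<open>I\<close>.\<close>

lemma graded_algebra_presented: "graded_algebra Q (presented_component G R d)"
proof (intro graded_algebra.intro complex_algebra_presented graded_algebra_axioms.intro)
  fix k l x y
  show "submodule (presented_component G R d k) complex_ring Q"
  proof (rule Q.submoduleI[OF presented_component_carrier])
    fix a
    assume "a \<in> presented_component G R d k"
    then obtain p where p: "p \<in> free_component G d k" "a = cls p"
      by (auto simp: presented_component_eq)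
    have "\<ominus>\<^bsub>Q\<^esub> cls p = cls (- p)"
      by (rule abelian_group.minus_equality[OF ring.is_abelian_group[OF ring_presented]])
        (use free_componentD[OF p(1)] in
          \<open>auto simp: presented_carrier presented_simps free_carrier_closed\<close>)
    then show "\<ominus>\<^bsub>Q\<^esub> a \<in> presented_component G R d k"
      using p by (auto simp: presented_component_eq intro: free_component_uminus)
  qed (auto simp: presented_component_eq presented_simps free_componentD
      intro: free_component_add free_component_scale)
  show "x \<otimes>\<^bsub>Q\<^esub> y \<in> presented_component G R d (k + l)"
    if "x \<in> presented_component G R d k" "y \<in> presented_component G R d l"
    using that by (auto simp: presented_component_eq presented_simps free_componentD
      intro: free_component_mult)
next
  fix x
  assume "x \<in> carrier Q"
  then obtain p where p: "p \<in> carrier F" and x: "x = cls p"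
    by (auto simp: presented_carrier)
  let ?f = "\<lambda>k. cls (homogeneous_part d k p)"
  have part: "homogeneous_part d k p \<in> carrier F" for k
    using homogeneous_part_in_component[OF p] by (rule free_componentD)
  let ?S = "word_degree d ` Poly_Mapping.keys p"
  show "\<exists>!f. (\<forall>k. f k \<in> presented_component G R d k) \<and> finite {k. f k \<noteq> \<zero>\<^bsub>Q\<^esub>} \<and>
      x = (\<Oplus>\<^bsub>Q\<^esub>k\<in>{k. f k \<noteq> \<zero>\<^bsub>Q\<^esub>}. f k)"
  proof (intro ex1I[of _ ?f] conjI allI)
    fix k
    show "?f k \<in> presented_component G R d k"
      using homogeneous_part_in_component[OF p] by (auto simp: presented_component_eq)
    have "homogeneous_part d k p = 0" if "k \<notin> ?S" for k
      using that by (intro poly_mapping_eqI) (auto simp: lookup_homogeneous_part in_keys_iff)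
    then have supp: "{k. ?f k \<noteq> \<zero>\<^bsub>Q\<^esub>} \<subseteq> ?S"
      by (auto simp: presented_simps)
    then show "finite {k. ?f k \<noteq> \<zero>\<^bsub>Q\<^esub>}"
      by (rule finite_subset) simp
    have "x = (\<Oplus>\<^bsub>Q\<^esub>k\<in>?S. ?f k)"
      using cls_finsum[of ?S "\<lambda>k. homogeneous_part d k p"] part
      by (simp add: sum_homogeneous_parts x)
    also have "\<dots> = (\<Oplus>\<^bsub>Q\<^esub>k\<in>{k. ?f k \<noteq> \<zero>\<^bsub>Q\<^esub>}. ?f k)"
      by (rule abelian_monoid.finsum_support[OF abelian_group.axioms(1)[OF ring.is_abelian_group[OF ring_presented]]]) (use supp part in \<open>auto simp: presented_carrier\<close>)
    finally show "x = (\<Oplus>\<^bsub>Q\<^esub>k\<in>{k. ?f k \<noteq> \<zero>\<^bsub>Q\<^esub>}. ?f k)" .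
  next
    fix f
    assume f: "(\<forall>k. f k \<in> presented_component G R d k) \<and> finite {k. f k \<noteq> \<zero>\<^bsub>Q\<^esub>} \<and>
      x = (\<Oplus>\<^bsub>Q\<^esub>k\<in>{k. f k \<noteq> \<zero>\<^bsub>Q\<^esub>}. f k)"
    let ?T = "{k. f k \<noteq> \<zero>\<^bsub>Q\<^esub>}"
    \<comment> \<open>The competing family \<open>f\<close> is lifted to homogeneous
      representatives.\<close>
    have "\<exists>g. \<forall>k. g k \<in> free_component G d k \<and> f k = cls (g k)"
      using f by (intro choice) (auto simp: presented_component_eq)
    then obtain g where g: "\<And>k. g k \<in> free_component G d k" "\<And>k. f k = cls (g k)"
      by blast
    have gF: "g k \<in> carrier F" for k
      using g(1) by (rule free_componentD)
    have "x = cls (\<Sum>k\<in>?T. g k)" and sum: "(\<Sum>k\<in>?T. g k) \<in> carrier F"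
      using cls_finsum[of ?T g] f gF by (simp_all add: g(2))
    then have "p - (\<Sum>k\<in>?T. g k) \<in> I"
      using p by (simp add: x cls_eq_iff)
    then have *: "homogeneous_part d k (p - (\<Sum>k\<in>?T. g k)) \<in> I" for k
      by (rule relation_ideal_homogeneous_part)
    show "f = ?f"
    proof
      fix k
      \<comment> \<open>The part of degree \<open>k\<close> compares \<open>p\<close> with the
        single summand \<open>g k\<close>, and it lies in \<open>I\<close> along with the whole
        difference. Outside the support the summand is 0, which represents \<open>f k\<close> as
        well.\<close>
      have "homogeneous_part d k (p - (\<Sum>k\<in>?T. g k)) =
          homogeneous_part d k p - (\<Sum>l\<in>?T. if k = l then g l else 0)"
        using homogeneous_part_component[OF g(1)]
        unfolding diff_conv_add_uminus homogeneous_part_add homogeneous_part_uminus homogeneous_part_sum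
        by simp
      also have "\<dots> = homogeneous_part d k p - (if k \<in> ?T then g k else 0)"
        using f by simp
      finally have "cls (homogeneous_part d k p) = cls (if k \<in> ?T then g k else 0)"
        using *[of k] part gF by (subst cls_eq_iff) auto
      then show "f k = ?f k"
        using g(2)[of k] by (auto simp: presented_simps)
    qed
  qed
qed

lemma presented_component_adj:
  "x \<in> presented_component G R d k \<Longrightarrow> adj Q x \<in> presented_component G R d (- k)"
  by (auto simp: presented_component_eq presented_simps free_componentD intro: free_component_adj)

end

section \<open>Veronese subalgebras\<close>

text \<open>
  Inside \<^locale>\<open>complex_algebra\<close> the unqualified ring facts refer to \<^const>\<open>ring_of_type_algebra\<close>.
  In the following locale they refer to the algebra.
\<close>

locale complex_algebra_ring = ring A
  for A :: "(complex, 'a, 'm) module_scheme" (structure) +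
  assumes complex_algebra: "complex_algebra A"
begin

lemma module: "module complex_ring A"
  using complex_algebra by (simp add: complex_algebra_def)

lemma smult_closed [simp, intro]: "x \<in> carrier A \<Longrightarrow> c \<odot> x \<in> carrier A"
  using module.smult_closed[OF module] by (simp add: complex_ring_simps)

lemma smult_l_distr: "x \<in> carrier A \<Longrightarrow> (c + c') \<odot> x = c \<odot> x \<oplus> c' \<odot> x"
  using module.smult_l_distr[OF module, of c c' x] by (simp add: complex_ring_simps)

lemma smult_r_distr:
  "x \<in> carrier A \<Longrightarrow> y \<in> carrier A \<Longrightarrow> c \<odot> (x \<oplus> y) = c \<odot> x \<oplus> c \<odot> y"
  using module.smult_r_distr[OF module, of c x y] by (simp add: complex_ring_simps)

lemma smult_smult: "x \<in> carrier A \<Longrightarrow> c \<odot> (c' \<odot> x) = (c * c') \<odot> x"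
  using module.smult_assoc1[OF module, of c c' x] by (simp add: complex_ring_simps)

lemma smult_one [simp]: "x \<in> carrier A \<Longrightarrow> 1 \<odot> x = x"
  using module.smult_one[OF module, of x] by (simp add: complex_ring_simps)

lemma smult_zero_left [simp]: "x \<in> carrier A \<Longrightarrow> 0 \<odot> x = \<zero>"
  using module.smult_l_null[OF module, of x] by (simp add: complex_ring_simps)

lemma smult_zero_right [simp]: "c \<odot> \<zero> = \<zero>"
  using module.smult_r_null[OF module, of c] by (simp add: complex_ring_simps)

lemma smult_minus_one: "x \<in> carrier A \<Longrightarrow> (- 1) \<odot> x = \<ominus> x"
  using smult_l_distr[of x "- 1" 1] by (intro minus_equality[symmetric]) simp_all

lemma smult_mult_left:
  "x \<in> carrier A \<Longrightarrow> y \<in> carrier A \<Longrightarrow> (c \<odot> x) \<otimes> y = c \<odot> (x \<otimes> y)"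
  by (rule complex_algebra.smult_mult_left[OF complex_algebra])

lemma smult_mult_right:
  "x \<in> carrier A \<Longrightarrow> y \<in> carrier A \<Longrightarrow> x \<otimes> (c \<odot> y) = c \<odot> (x \<otimes> y)"
  by (rule complex_algebra.smult_mult_right[OF complex_algebra])

lemma submoduleI:
  assumes "H \<subseteq> carrier A" "\<zero> \<in> H" "\<And>x y. x \<in> H \<Longrightarrow> y \<in> H \<Longrightarrow> x \<oplus> y \<in> H"
    and "\<And>c x. x \<in> H \<Longrightarrow> c \<odot> x \<in> H"
  shows "submodule H complex_ring A"
  by (rule module.submoduleI[OF module])
    (use assms in \<open>auto simp: subset_iff simp flip: smult_minus_one\<close>)

lemma submoduleD:
  assumes "submodule H complex_ring A"
  shows "H \<subseteq> carrier A" "\<zero> \<in> H" "\<And>x y. x \<in> H \<Longrightarrow> y \<in> H \<Longrightarrow> x \<oplus> y \<in> H"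
    "\<And>c x. x \<in> H \<Longrightarrow> c \<odot> x \<in> H" "\<And>x. x \<in> H \<Longrightarrow> \<ominus> x \<in> H"
    "\<And>x y. x \<in> H \<Longrightarrow> y \<in> H \<Longrightarrow> x \<ominus> y \<in> H"
proof -
  note E = module.submoduleE[OF module assms]
  show "H \<subseteq> carrier A" "\<And>x y. x \<in> H \<Longrightarrow> y \<in> H \<Longrightarrow> x \<oplus> y \<in> H"
    "\<And>x. x \<in> H \<Longrightarrow> \<ominus> x \<in> H" "\<And>x y. x \<in> H \<Longrightarrow> y \<in> H \<Longrightarrow> x \<ominus> y \<in> H"
    using E by (auto simp: a_minus_def)
  show smult: "\<And>c x. x \<in> H \<Longrightarrow> c \<odot> x \<in> H"
    using E(4) by (simp add: complex_ring_simps)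
  obtain x where "x \<in> H"
    using E(2) by blast
  then show "\<zero> \<in> H"
    using smult[of x 0] E(1) by auto
qed

lemma submodule_finsum:
  assumes "submodule H complex_ring A" "\<And>i. i \<in> S \<Longrightarrow> f i \<in> H"
  shows "(\<Oplus>i\<in>S. f i) \<in> H"
  using assms(2)
proof (induction S rule: infinite_finite_induct)
  case (insert x S)
  have "f \<in> S \<rightarrow> carrier A" "f x \<in> carrier A"
    using insert.prems submoduleD(1)[OF assms(1)] by auto
  then show ?case
    using insert submoduleD(3)[OF assms(1)] by simp
qed (use submoduleD(2)[OF assms(1)] in auto)

lemma linear_span_submodule:
  assumes "S \<subseteq> carrier A"
  shows "submodule (linear_span A S) complex_ring A"
proof (rule submoduleI)
  \<comment> \<open>The carrier is one of the submodules being intersected, which keeps the span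
    inside it.\<close>
  have "submodule (carrier A) complex_ring A"
    by (rule submoduleI) auto
  then show "linear_span A S \<subseteq> carrier A"
    unfolding linear_span_def using assms by blast
qed (auto simp: linear_span_def dest: submoduleD(2-4))

lemma linear_span_superset: "S \<subseteq> linear_span A S"
  by (auto simp: linear_span_def)

lemma linear_span_minimal: "submodule U complex_ring A \<Longrightarrow> S \<subseteq> U \<Longrightarrow> linear_span A S \<subseteq> U"
  by (auto simp: linear_span_def)

lemma linear_span_induct [consumes 2, case_names base zero add smult]:
  assumes "x \<in> linear_span A S" and S: "S \<subseteq> carrier A"
    and base: "\<And>x. x \<in> S \<Longrightarrow> P x" and zero: "P \<zero>"
    and add: "\<And>x y. x \<in> carrier A \<Longrightarrow> y \<in> carrier A \<Longrightarrow> P x \<Longrightarrow> P y \<Longrightarrow> P (x \<oplus> y)"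
    and smult: "\<And>c x. x \<in> carrier A \<Longrightarrow> P x \<Longrightarrow> P (c \<odot> x)"
  shows "P x"
proof -
  have "submodule {x \<in> carrier A. P x} complex_ring A"
    by (rule submoduleI) (use zero add smult in auto)
  then have "linear_span A S \<subseteq> {x \<in> carrier A. P x}"
    by (rule linear_span_minimal) (use base S in auto)
  then show ?thesis
    using assms(1) by blast
qed

text \<open>Bilinearity: for a fixed generator \<open>s\<close> the claim is linear in
  \<open>y\<close>, and once it holds for all generators it is linear in \<open>x\<close>.\<close>

lemma linear_span_mult:
  assumes U: "submodule U complex_ring A" and S: "S \<subseteq> carrier A" and T: "T \<subseteq> carrier A"
    and ST: "\<And>s t. s \<in> S \<Longrightarrow> t \<in> T \<Longrightarrow> s \<otimes> t \<in> U"
    and x: "x \<in> linear_span A S" and y: "y \<in> linear_span A T"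
  shows "x \<otimes> y \<in> U"
proof -
  have yc: "y \<in> carrier A"
    using submoduleD(1)[OF linear_span_submodule[OF T]] y by blast
  have 1: "s \<otimes> y \<in> U" if s: "s \<in> S" for s
    using y T
  proof (induction rule: linear_span_induct)
    case (base t)
    then show ?case
      using ST s by simp
  next
    case zero
    show ?case
      using s S submoduleD(2)[OF U] by auto
  qed (use s S submoduleD[OF U] in \<open>auto simp: r_distr smult_mult_right subset_iff\<close>)
  show ?thesis
    using x S
  proof (induction rule: linear_span_induct)
    case (base s)
    then show ?case
      by (rule 1)
  qed (use yc submoduleD[OF U] in \<open>auto simp: l_distr smult_mult_left\<close>)
qed

lemma subalgebra:
  assumes V: "submodule V complex_ring A" and one: "\<one> \<in> V"
    and mult: "\<And>x y. x \<in> V \<Longrightarrow> y \<in> V \<Longrightarrow> x \<otimes> y \<in> V"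
  shows "complex_algebra_ring (A\<lparr>carrier := V\<rparr>)"
proof -
  note Vc = submoduleD(1)[OF V, THEN subsetD]
  have "abelian_group (A\<lparr>carrier := V\<rparr>)"
    by (rule module.axioms(2)[OF submodule.submodule_is_module[OF V module]])
  moreover have "Group.monoid (A\<lparr>carrier := V\<rparr>)"
    by (rule monoidI) (auto simp: one mult Vc m_assoc)
  ultimately have ring: "ring (A\<lparr>carrier := V\<rparr>)"
    by (rule ringI) (auto simp: Vc l_distr r_distr)
  then have "complex_algebra (A\<lparr>carrier := V\<rparr>)"
    by (intro complex_algebra.intro submodule.submodule_is_module[OF V module]
        complex_algebra_axioms.intro) (auto simp: Vc smult_mult_left smult_mult_right)
  with ring show ?thesis
    by (intro complex_algebra_ring.intro complex_algebra_ring_axioms.intro)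
qed

end

lemma complex_algebra_ringI: "complex_algebra A \<Longrightarrow> complex_algebra_ring A"
  by (simp add: complex_algebra_ring_def complex_algebra_ring_axioms_def complex_algebra_def)

text \<open>Spans are intersections of submodules and so refer to the ambient algebra. This
  transfers them between an algebra and a subalgebra.\<close>

lemma submodule_subalgebra_iff:
  assumes "complex_algebra_ring A" and "complex_algebra_ring (A\<lparr>carrier := V\<rparr>)"
    and "V \<subseteq> carrier A"
  shows "submodule H complex_ring (A\<lparr>carrier := V\<rparr>) \<longleftrightarrow> H \<subseteq> V \<and> submodule H complex_ring A"
proof -
  interpret A: complex_algebra_ring A by fact
  interpret V: complex_algebra_ring "A\<lparr>carrier := V\<rparr>" by fact
  show ?thesis
  proof
    assume "submodule H complex_ring (A\<lparr>carrier := V\<rparr>)"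
    note D = V.submoduleD[OF this]
    show "H \<subseteq> V \<and> submodule H complex_ring A"
      using D assms(3) by (intro conjI A.submoduleI) auto
  next
    assume *: "H \<subseteq> V \<and> submodule H complex_ring A"
    then have "submodule H complex_ring A"
      by simp
    note D = A.submoduleD[OF this]
    show "submodule H complex_ring (A\<lparr>carrier := V\<rparr>)"
      using D * by (intro V.submoduleI) auto
  qed
qed

section \<open>Graded algebras and their Veronese subalgebras\<close>

locale graded_algebra_ring = complex_algebra_ring A
  for A :: "(complex, 'a, 'm) module_scheme" (structure) and \<A> :: "int \<Rightarrow> 'a set" +
  assumes graded: "graded_algebra A \<A>"
begin

lemma component_submodule: "submodule (\<A> k) complex_ring A"
  by (rule graded_algebra.component_submodule[OF graded])

lemmas componentD = submoduleD[OF component_submodule]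

lemma component_carrier: "x \<in> \<A> k \<Longrightarrow> x \<in> carrier A"
  using componentD(1) by blast

lemma component_mult: "x \<in> \<A> k \<Longrightarrow> y \<in> \<A> l \<Longrightarrow> x \<otimes> y \<in> \<A> (k + l)"
  by (rule graded_algebra.component_mult[OF graded])

lemma decomposition_unique:
  assumes "\<And>k. f k \<in> \<A> k" "\<And>k. g k \<in> \<A> k" "finite {k. f k \<noteq> \<zero>}" "finite {k. g k \<noteq> \<zero>}"
    and "(\<Oplus>k\<in>{k. f k \<noteq> \<zero>}. f k) = (\<Oplus>k\<in>{k. g k \<noteq> \<zero>}. g k)"
  shows "f = g"
proof -
  let ?x = "\<Oplus>k\<in>{k. f k \<noteq> \<zero>}. f k"
  have "?x \<in> carrier A"
    using assms(1) component_carrier by (intro finsum_closed) auto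
  from graded_algebra.direct_sum[OF graded this] show ?thesis
    using assms by (elim ex1E) metis
qed

end

text \<open>\<open>N_pos\<close> makes multiplication of degrees by \<open>N\<close> injective, so
  that the regraded components stay independent; \<open>one_component\<close> puts the unit into the
  subalgebra.\<close>

locale veronese_data = graded_algebra_ring A \<A>
  for A :: "(complex, 'a, 'm) module_scheme" (structure) and \<A> :: "int \<Rightarrow> 'a set" +
  fixes N :: nat
  assumes N_pos: "0 < N" and one_component: "\<one> \<in> \<A> 0"
begin

abbreviation "V \<equiv> linear_span A (\<Union>k \<in> {k. int N dvd k}. \<A> k)"
abbreviation "B \<equiv> veronese A \<A> N"

lemma veronese_eq: "B = A\<lparr>carrier := V\<rparr>"
  by (simp add: veronese_def)

lemma generators_carrier: "(\<Union>k \<in> {k. int N dvd k}. \<A> k) \<subseteq> carrier A"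
  using component_carrier by auto

lemma V_submodule: "submodule V complex_ring A"
  by (rule linear_span_submodule[OF generators_carrier])

lemma V_carrier: "V \<subseteq> carrier A"
  by (rule submoduleD(1)[OF V_submodule])

lemma component_V: "\<A> (k * int N) \<subseteq> V"
proof -
  have "\<A> (k * int N) \<subseteq> (\<Union>k \<in> {k. int N dvd k}. \<A> k)"
    by (rule UN_upper) simp
  then show ?thesis
    using linear_span_superset by (rule order_trans)
qed

lemma V_mult:
  assumes "x \<in> V" "y \<in> V"
  shows "x \<otimes> y \<in> V"
proof (rule linear_span_mult[OF V_submodule generators_carrier generators_carrier _ assms])
  fix s t
  assume "s \<in> (\<Union>k \<in> {k. int N dvd k}. \<A> k)" "t \<in> (\<Union>k \<in> {k. int N dvd k}. \<A> k)"
  then obtain k l where "int N dvd k" "s \<in> \<A> k" "int N dvd l" "t \<in> \<A> l"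
    by blast
  then have "int N dvd k + l" "s \<otimes> t \<in> \<A> (k + l)"
    by (simp_all add: component_mult)
  then have "s \<otimes> t \<in> (\<Union>k \<in> {k. int N dvd k}. \<A> k)"
    by blast
  then show "s \<otimes> t \<in> V"
    by (rule subsetD[OF linear_span_superset])
qed

lemma one_V: "\<one> \<in> V"
  using subsetD[OF component_V[of 0]] one_component by simp

lemma veronese_complex_algebra: "complex_algebra_ring B"
  unfolding veronese_eq using V_submodule one_V V_mult by (rule subalgebra)

lemma submodule_veronese_iff:
  "submodule H complex_ring B \<longleftrightarrow> H \<subseteq> V \<and> submodule H complex_ring A"
  unfolding veronese_eq
  by (rule submodule_subalgebra_iff[OF complex_algebra_ring_axioms
        veronese_complex_algebra[unfolded veronese_eq] V_carrier])

text \<open>\<open>finsum\<close> is defined through the whole algebra record, so a change of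
  carrier has to be justified. For infinite index sets both sides take the default value
  zero.\<close>

lemma veronese_finsum:
  assumes "\<And>i. i \<in> S \<Longrightarrow> f i \<in> V"
  shows "finsum B f S = finsum A f S"
proof -
  interpret B: complex_algebra_ring B
    by (rule veronese_complex_algebra)
  have zero: "\<zero>\<^bsub>B\<^esub> = \<zero>"
    by (simp add: veronese_eq)
  show ?thesis
    using assms
  proof (induction S rule: infinite_finite_induct)
    case (infinite S)
    then show ?case
      by (simp add: zero)
  next
    case empty
    show ?case
      by (simp add: zero)
  next
    case (insert x S)
    have V: "f i \<in> V" if "i \<in> insert x S" for i
      using insert.prems that by blast
    then have A: "f i \<in> carrier A" if "i \<in> insert x S" for i
      using V_carrier that by blast
    have "finsum B f (insert x S) = f x \<oplus>\<^bsub>B\<^esub> finsum B f S"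
      by (rule B.finsum_insert) (use insert.hyps V in \<open>auto simp: veronese_eq Pi_iff\<close>)
    also have "\<dots> = f x \<oplus> finsum A f S"
      using insert.IH insert.prems by (simp add: veronese_eq)
    also have "\<dots> = finsum A f (insert x S)"
      by (rule finsum_insert[symmetric]) (use insert.hyps A in \<open>auto simp: Pi_iff\<close>)
    finally show ?case .
  qed
qed

text \<open>The finite set \<open>S\<close> merely contains the support: summands may cancel and
  scaling by 0 kills them, so exact supports would not survive the induction over the span.\<close>

lemma veronese_decomposition:
  assumes "x \<in> V"
  shows "\<exists>f S. (\<forall>k. f k \<in> \<A> (k * int N)) \<and> finite S \<and> (\<forall>k. k \<notin> S \<longrightarrow> f k = \<zero>) \<and> x = (\<Oplus>k\<in>S. f k)"
proof -
  define dec where "dec x f S \<longleftrightarrow> (\<forall>k. f k \<in> \<A> (k * int N)) \<and> finite S \<and>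
    (\<forall>k. k \<notin> S \<longrightarrow> f k = \<zero>) \<and> x = (\<Oplus>k\<in>S. f k)" for x f S
  have "\<exists>f S. dec x f S"
    using assms generators_carrier
  proof (induction rule: linear_span_induct)
    case (base x)
    then obtain j where "int N dvd j" "x \<in> \<A> j"
      by blast
    then obtain k where k: "x \<in> \<A> (k * int N)"
      using that[of "j div int N"] by simp
    then have "dec x (\<lambda>l. if l = k then x else \<zero>) {k}"
      using componentD(2) component_carrier by (simp add: dec_def)
    then show ?case
      by (intro exI)
  next
    case zero
    have "dec \<zero> (\<lambda>_. \<zero>) {}"
      using componentD(2) by (simp add: dec_def)
    then show ?case
      by (intro exI)
  next
    case (add x y)
    then obtain f S g T where f: "dec x f S" and g: "dec y g T"
      by blast
    have carr: "f k \<in> carrier A" "g k \<in> carrier A" for k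
      using f g component_carrier by (auto simp: dec_def)
    have "x = (\<Oplus>k\<in>S \<union> T. f k)" "y = (\<Oplus>k\<in>S \<union> T. g k)"
      using f g carr by (auto simp: dec_def intro!: add.finprod_mono_neutral_cong_left)
    then have "x \<oplus> y = (\<Oplus>k\<in>S \<union> T. f k \<oplus> g k)"
      using carr by (simp add: finsum_addf)
    then have "dec (x \<oplus> y) (\<lambda>k. f k \<oplus> g k) (S \<union> T)"
      using f g componentD(3) by (simp add: dec_def)
    then show ?case
      by (intro exI)
  next
    case (smult c x)
    then obtain f S where f: "dec x f S"
      by blast
    have carr: "f k \<in> carrier A" for k
      using f component_carrier by (auto simp: dec_def)
    then have "c \<odot> (\<Oplus>k\<in>S. f k) = (\<Oplus>k\<in>S. c \<odot> f k)"
      using f module.finsum_smult_ldistr[OF module, of S c f]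
      by (simp add: complex_ring_simps dec_def)
    then have "dec (c \<odot> x) (\<lambda>k. c \<odot> f k) S"
      using f componentD(4) by (simp add: dec_def)
    then show ?case
      by (intro exI)
  qed
  then show ?thesis
    by (simp add: dec_def)
qed

lemma veronese_decomposition_unique:
  assumes f: "\<And>k. f k \<in> \<A> (k * int N)" "finite {k. f k \<noteq> \<zero>}"
    and g: "\<And>k. g k \<in> \<A> (k * int N)" "finite {k. g k \<noteq> \<zero>}"
    and eq: "(\<Oplus>k\<in>{k. f k \<noteq> \<zero>}. f k) = (\<Oplus>k\<in>{k. g k \<noteq> \<zero>}. g k)"
  shows "f = g"
proof -
  \<comment> \<open>Extension by zero to the degrees not divisible by \<open>N\<close> gives a
    family for the full grading, where uniqueness is known.\<close>
  define lift where "lift f j = (if int N dvd j then f (j div int N) else \<zero>)" for f :: "int \<Rightarrow> 'a" and j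
  have lift_mult: "lift f (k * int N) = f k" for f k
    using N_pos by (simp add: lift_def)
  have lift: "(\<forall>j. lift f j \<in> \<A> j) \<and> finite {j. lift f j \<noteq> \<zero>} \<and>
      (\<Oplus>j\<in>{j. lift f j \<noteq> \<zero>}. lift f j) = (\<Oplus>k\<in>{k. f k \<noteq> \<zero>}. f k)"
    if f: "\<And>k. f k \<in> \<A> (k * int N)" "finite {k. f k \<noteq> \<zero>}" for f
  proof -
    \<comment> \<open>Multiplication by \<open>N\<close> is injective, hence a sum over this support
      can be reindexed.\<close>
    have supp: "{j. lift f j \<noteq> \<zero>} = (\<lambda>k. k * int N) ` {k. f k \<noteq> \<zero>}"
      using N_pos by (auto simp: lift_def split: if_splits)
    have mem: "lift f j \<in> \<A> j" for j
      using f(1)[of "j div int N"] componentD(2) by (auto simp: lift_def)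
    have "(\<Oplus>j\<in>{j. lift f j \<noteq> \<zero>}. lift f j) = (\<Oplus>k\<in>{k. f k \<noteq> \<zero>}. lift f (k * int N))"
      unfolding supp
      by (rule finsum_reindex) (use N_pos mem component_carrier in \<open>auto simp: inj_on_def\<close>)
    then show ?thesis
      using mem f(2) unfolding lift_mult supp by simp
  qed
  have "lift f = lift g"
    by (rule decomposition_unique) (use lift[OF f] lift[OF g] eq in auto)
  then show ?thesis
    using lift_mult by (metis ext)
qed

lemma graded_veronese: "graded_algebra B (veronese_grading \<A> N)"
proof (rule graded_algebra.intro)
  interpret B: complex_algebra_ring B
    by (rule veronese_complex_algebra)
  show "complex_algebra B"
    by (rule B.complex_algebra)
  show "graded_algebra_axioms B (veronese_grading \<A> N)"
  proof (rule graded_algebra_axioms.intro)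
    fix k l x y
    show "submodule (veronese_grading \<A> N k) complex_ring B"
      unfolding submodule_veronese_iff veronese_grading_def
      using component_V component_submodule by blast
    show "x \<otimes>\<^bsub>B\<^esub> y \<in> veronese_grading \<A> N (k + l)"
      if "x \<in> veronese_grading \<A> N k" "y \<in> veronese_grading \<A> N l"
      using that component_mult[of x "k * int N" y "l * int N"]
      by (simp add: veronese_grading_def veronese_eq algebra_simps)
  next
    fix x
    assume "x \<in> carrier B"
    then have "x \<in> V"
      by (simp add: veronese_eq)
    then obtain f S where f: "\<forall>k. f k \<in> \<A> (k * int N)" and S: "finite S" "\<forall>k. k \<notin> S \<longrightarrow> f k = \<zero>"
      and x: "x = (\<Oplus>k\<in>S. f k)"
      using veronese_decomposition by blast
    have supp: "{k. f k \<noteq> \<zero>} \<subseteq> S"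
      using S(2) by auto
    have x': "x = (\<Oplus>k\<in>{k. f k \<noteq> \<zero>}. f k)"
      unfolding x by (rule finsum_support) (use f S(1) supp component_carrier in auto)
    have finsum: "finsum B g T = finsum A g T" if "\<forall>k. g k \<in> \<A> (k * int N)" for g T
      by (rule veronese_finsum) (use that component_V in blast)
    have zero: "\<zero>\<^bsub>B\<^esub> = \<zero>"
      by (simp add: veronese_eq)
    show "\<exists>!f. (\<forall>k. f k \<in> veronese_grading \<A> N k) \<and> finite {k. f k \<noteq> \<zero>\<^bsub>B\<^esub>} \<and>
        x = (\<Oplus>\<^bsub>B\<^esub>k\<in>{k. f k \<noteq> \<zero>\<^bsub>B\<^esub>}. f k)"
      unfolding zero veronese_grading_def
    proof (intro ex1I[of _ f])
      show "(\<forall>k. f k \<in> \<A> (k * int N)) \<and> finite {k. f k \<noteq> \<zero>} \<and> x = (\<Oplus>\<^bsub>B\<^esub>k\<in>{k. f k \<noteq> \<zero>}. f k)"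
        using f x' finite_subset[OF supp S(1)] finsum by simp
      show "g = f" if "(\<forall>k. g k \<in> \<A> (k * int N)) \<and> finite {k. g k \<noteq> \<zero>} \<and> x = (\<Oplus>\<^bsub>B\<^esub>k\<in>{k. g k \<noteq> \<zero>}. g k)" for g
        by (rule veronese_decomposition_unique)
          (use that f x' finite_subset[OF supp S(1)] finsum in auto)
    qed
  qed
qed

text \<open>If 1 is a combination of products a b of degrees k N and -k N, then x = 1 x is the same
  combination of the products a (b x). For x of degree (k + l) N the factor b x has degree l
  N.\<close>

lemma strongly_graded_veronese:
  assumes one_span: "\<And>k. \<one> \<in> linear_span A {x \<otimes> y | x y. x \<in> \<A> (k * int N) \<and> y \<in> \<A> (- (k * int N))}"
  shows "strongly_graded_algebra B (veronese_grading \<A> N)"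
proof (intro strongly_graded_algebra.intro graded_veronese strongly_graded_algebra_axioms.intro)
  fix k l
  interpret B: complex_algebra_ring B
    by (rule veronese_complex_algebra)
  let ?A = "veronese_grading \<A> N"
  let ?S = "{x \<otimes>\<^bsub>B\<^esub> y | x y. x \<in> ?A k \<and> y \<in> ?A l}"
  have sub: "submodule (?A j) complex_ring B" for j
    by (rule graded_algebra.component_submodule[OF graded_veronese])
  have S: "?S \<subseteq> ?A (k + l)"
    using graded_algebra.component_mult[OF graded_veronese] by blast
  have SV: "?S \<subseteq> carrier B"
    using S B.submoduleD(1)[OF sub] by blast
  show "linear_span B ?S = ?A (k + l)"
  proof
    show "linear_span B ?S \<subseteq> ?A (k + l)"
      by (rule B.linear_span_minimal[OF sub S])
    show "?A (k + l) \<subseteq> linear_span B ?S"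
    proof
      fix x
      assume "x \<in> ?A (k + l)"
      then have x: "x \<in> \<A> (k * int N + l * int N)"
        by (simp add: veronese_grading_def algebra_simps)
      \<comment> \<open>The bilinearity argument takes place in \<open>A\<close>, so the span formed
        in the subalgebra must be a submodule of \<open>A\<close>.\<close>
      have U: "submodule (linear_span B ?S) complex_ring A"
        using B.linear_span_submodule[OF SV] submodule_veronese_iff by blast
      have "\<one> \<otimes> x \<in> linear_span B ?S"
      proof (rule linear_span_mult[OF U _ _ _ one_span[of k]])
        show "{x \<otimes> y | x y. x \<in> \<A> (k * int N) \<and> y \<in> \<A> (- (k * int N))} \<subseteq> carrier A"
          by (blast intro: m_closed component_carrier)
        show "{x} \<subseteq> carrier A"
          using x component_carrier by blast
        show "x \<in> linear_span A {x}"
          by (rule subsetD[OF linear_span_superset]) simp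
        show "s \<otimes> t \<in> linear_span B ?S"
          if s: "s \<in> {x \<otimes> y | x y. x \<in> \<A> (k * int N) \<and> y \<in> \<A> (- (k * int N))}" and t: "t \<in> {x}" for s t
        proof -
          obtain a b where ab: "a \<in> \<A> (k * int N)" "b \<in> \<A> (- (k * int N))" "s = a \<otimes> b"
            using s by blast
          then have "b \<otimes> x \<in> \<A> (l * int N)"
            using component_mult[OF ab(2) x] by simp
          moreover have "s \<otimes> t = a \<otimes> (b \<otimes> x)"
            using ab t x component_carrier by (simp add: m_assoc)
          ultimately have "s \<otimes> t \<in> ?S"
            using ab(1) unfolding veronese_grading_def veronese_eq by auto
          then show ?thesis
            by (rule subsetD[OF B.linear_span_superset])
        qed
      qed
      then show "x \<in> linear_span B ?S"
        using x component_carrier by simp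
    qed
  qed
qed

end

text \<open>The adjoint negates degrees and divisibility by \<open>N\<close> ignores the sign, so
  the spanning set is closed under adjoints; conjugate linearity extends this to the span.\<close>

lemma complex_star_algebra_veronese:
  fixes A :: "('a, 'm) star_alg_scheme"
  assumes "complex_star_algebra A" and "veronese_data A \<A> N"
    and adj: "\<And>k x. x \<in> \<A> k \<Longrightarrow> adj A x \<in> \<A> (- k)"
  shows "complex_star_algebra (veronese A \<A> N)"
proof -
  interpret veronese_data A \<A> N by fact
  note star = complex_star_algebra.adj_closed[OF assms(1)] complex_star_algebra.adj_adj[OF assms(1)]
    complex_star_algebra.adj_add[OF assms(1)] complex_star_algebra.adj_smult[OF assms(1)]
    complex_star_algebra.adj_mult[OF assms(1)]
  have adj_V: "adj A x \<in> V" if "x \<in> V" for x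
    using that generators_carrier
  proof (induction rule: linear_span_induct)
    case (base x)
    then obtain k where "int N dvd k" "x \<in> \<A> k"
      by blast
    then have "int N dvd - k" "adj A x \<in> \<A> (- k)"
      by (simp_all add: adj)
    then have "adj A x \<in> (\<Union>k \<in> {k. int N dvd k}. \<A> k)"
      by blast
    then show ?case
      by (rule subsetD[OF linear_span_superset])
  next
    case zero
    \<comment> \<open>Conjugate linearity at the scalar 0.\<close>
    have "adj A \<zero>\<^bsub>A\<^esub> = \<zero>\<^bsub>A\<^esub>"
      using star(4)[of "\<zero>\<^bsub>A\<^esub>" 0] star(1)[of "\<zero>\<^bsub>A\<^esub>"] by simp
    then show ?case
      using submoduleD(2)[OF V_submodule] by simp
  next
    case (add x y)
    then show ?case
      using submoduleD(3)[OF V_submodule] by (simp add: star)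
  next
    case (smult c x)
    then show ?case
      using submoduleD(4)[OF V_submodule] by (simp add: star)
  qed
  have "complex_algebra B"
    by (rule complex_algebra_ring.complex_algebra[OF veronese_complex_algebra])
  moreover have "x \<in> carrier A" if "x \<in> V" for x
    using V_carrier that by blast
  ultimately show ?thesis
    by (intro complex_star_algebra.intro complex_star_algebra_axioms.intro)
      (simp_all add: adj_V star veronese_eq)
qed

section \<open>A criterion for strong gradings\<close>

context complex_algebra_ring
begin

lemma commute_pow:
  assumes "a \<in> carrier A" "y \<in> carrier A" and "a \<otimes> y = t \<odot> (y \<otimes> a)"
  shows "a [^] (l::nat) \<otimes> y = t ^ l \<odot> (y \<otimes> a [^] l)"
proof (induction l)
  case (Suc l)
  have "a [^] Suc l \<otimes> y = a [^] l \<otimes> (a \<otimes> y)"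
    using assms by (simp add: m_assoc)
  also have "\<dots> = t \<odot> ((a [^] l \<otimes> y) \<otimes> a)"
    using assms by (simp add: smult_mult_right m_assoc)
  also have "\<dots> = t ^ Suc l \<odot> (y \<otimes> a [^] Suc l)"
    using assms by (simp add: Suc smult_mult_left smult_smult m_assoc)
  finally show ?case .
qed (use assms in simp)

text \<open>The innermost factor is peeled off: a^(l+1) b^(l+1) = a^l (a b) b^l. Moving y and y' to
  the left through a^l costs only a factor t^l on y', and a^l b^l is known by induction.
  \<open>H\<close> will be the degree-zero part.\<close>

lemma pow_mult_pow_expand:
  assumes H: "submodule H complex_ring A" "\<one> \<in> H" "\<And>u v. u \<in> H \<Longrightarrow> v \<in> H \<Longrightarrow> u \<otimes> v \<in> H"
    and y: "y \<in> H" "y' \<in> H" "y \<otimes> y' = y' \<otimes> y"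
    and ab: "a \<in> carrier A" "b \<in> carrier A" "a \<otimes> b = y \<oplus> c \<odot> y'"
    and comm: "a \<otimes> y = y \<otimes> a" "a \<otimes> y' = t \<odot> (y' \<otimes> a)"
  shows "\<exists>r\<in>H. r \<otimes> y' = y' \<otimes> r \<and> a [^] (l::nat) \<otimes> b [^] l = y [^] l \<oplus> y' \<otimes> r"
proof (induction l)
  case 0
  show ?case
    by (rule bexI[of _ \<zero>]) (use y submoduleD[OF H(1)] in auto)
next
  case (Suc l)
  note D = submoduleD[OF H(1)]
  obtain r where r: "r \<in> H" "r \<otimes> y' = y' \<otimes> r" "a [^] l \<otimes> b [^] l = y [^] l \<oplus> y' \<otimes> r"
    using Suc by blast
  define P where "P = y [^] l \<oplus> y' \<otimes> r"
  \<comment> \<open>What remains of y P + c t^l y' P after removing y^(l+1) and the left factor y',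
    which is first moved past y in y y' r.\<close>
  define r' where "r' = y \<otimes> r \<oplus> (c * t ^ l) \<odot> P"
  have carr: "y \<in> carrier A" "y' \<in> carrier A" "r \<in> carrier A"
    using y r D(1) by auto
  then have Pc: "P \<in> carrier A"
    by (simp add: P_def)
  have yl: "y [^] (k::nat) \<in> H" for k
    by (induction k) (simp_all add: H y)
  then have PH: "P \<in> H"
    by (simp add: P_def H D y r)
  then have r'H: "r' \<in> H"
    by (simp add: r'_def H D y r)
  have yl_comm: "y [^] l \<otimes> y' = y' \<otimes> y [^] l"
    using commute_pow[of y y' 1 l] y(3) carr by simp
  have P_comm: "P \<otimes> y' = y' \<otimes> P"
    using carr yl_comm by (simp add: P_def l_distr r_distr m_assoc r(2))
  have "y \<otimes> r \<otimes> y' = y' \<otimes> (y \<otimes> r)"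
    using carr by (metis m_assoc r(2) y(3))
  then have r'_comm: "r' \<otimes> y' = y' \<otimes> r'"
    using carr Pc P_comm by (simp add: r'_def l_distr r_distr smult_mult_left smult_mult_right)
  have "a [^] Suc l \<otimes> b [^] Suc l = (a [^] l \<otimes> (a \<otimes> b)) \<otimes> b [^] l"
    unfolding nat_pow_Suc2[OF ab(2)] using ab(1,2) by (simp add: m_assoc)
  also have "a [^] l \<otimes> (a \<otimes> b) = y \<otimes> a [^] l \<oplus> (c * t ^ l) \<odot> (y' \<otimes> a [^] l)"
    using commute_pow[of a y 1 l] commute_pow[of a y' t l] comm ab carr
    by (simp add: r_distr smult_mult_right smult_smult)
  also have "\<dots> \<otimes> b [^] l = y \<otimes> (a [^] l \<otimes> b [^] l) \<oplus> (c * t ^ l) \<odot> (y' \<otimes> (a [^] l \<otimes> b [^] l))"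
    using ab(1,2) carr by (simp add: l_distr smult_mult_left m_assoc)
  also have "\<dots> = y \<otimes> P \<oplus> (c * t ^ l) \<odot> (y' \<otimes> P)"
    by (simp add: r(3) P_def)
  also have "y \<otimes> P = y [^] Suc l \<oplus> y' \<otimes> (y \<otimes> r)"
    unfolding P_def nat_pow_Suc2[OF carr(1)]
    using carr by (simp add: r_distr y(3) flip: m_assoc)
  also have "\<dots> \<oplus> (c * t ^ l) \<odot> (y' \<otimes> P) = y [^] Suc l \<oplus> y' \<otimes> r'"
    using carr Pc by (simp add: r'_def r_distr smult_mult_right a_assoc)
  finally show ?case
    using r'H r'_comm by blast
qed

text \<open>Each term of the expanded power that contains \<open>p\<close> lies in \<open>J\<close>,
  a two-sided ideal of \<open>H\<close>; only the pure power of \<open>s\<close> is left, even if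
  \<open>p\<close> and \<open>s\<close> do not commute.\<close>

lemma add_pow_mod:
  assumes H: "submodule H complex_ring A" "\<one> \<in> H" "\<And>u v. u \<in> H \<Longrightarrow> v \<in> H \<Longrightarrow> u \<otimes> v \<in> H"
    and J: "submodule J complex_ring A" "J \<subseteq> H"
      "\<And>u v. u \<in> H \<Longrightarrow> v \<in> J \<Longrightarrow> u \<otimes> v \<in> J" "\<And>u v. u \<in> H \<Longrightarrow> v \<in> J \<Longrightarrow> v \<otimes> u \<in> J"
    and p: "p \<in> J" and s: "s \<in> H"
  shows "\<exists>j\<in>J. (p \<oplus> s) [^] (k::nat) = j \<oplus> s [^] k"
proof (induction k)
  case 0
  show ?case
    by (rule bexI[of _ \<zero>]) (use submoduleD[OF J(1)] in auto)
next
  case (Suc k)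
  note D = submoduleD[OF J(1)] and DH = submoduleD[OF H(1)]
  obtain j where j: "j \<in> J" "(p \<oplus> s) [^] k = j \<oplus> s [^] k"
    using Suc by blast
  have sk: "s [^] k \<in> H"
    using s H by (induction k) auto
  have carr: "p \<in> carrier A" "s \<in> carrier A" "j \<in> carrier A"
    using p s j D DH by auto
  have "(p \<oplus> s) [^] Suc k = (j \<otimes> (p \<oplus> s) \<oplus> s [^] k \<otimes> p) \<oplus> s [^] Suc k"
    using carr by (simp add: j(2) l_distr r_distr a_ac)
  moreover have "j \<otimes> (p \<oplus> s) \<oplus> s [^] k \<otimes> p \<in> J"
    using J j p s sk D DH by (meson subsetD)
  ultimately show ?case
    by blast
qed

end

section \<open>Products of opposite degrees as an ideal of the degree-zero part\<close>

context graded_algebra_ring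
begin

abbreviation "product_span M \<equiv> linear_span A {x \<otimes> y | x y. x \<in> \<A> M \<and> y \<in> \<A> (- M)}"

lemma products_subset: "{x \<otimes> y | x y. x \<in> \<A> M \<and> y \<in> \<A> (- M)} \<subseteq> \<A> 0"
  using component_mult[of _ M _ "- M"] by auto

lemma products_carrier: "{x \<otimes> y | x y. x \<in> \<A> M \<and> y \<in> \<A> (- M)} \<subseteq> carrier A"
  using products_subset componentD(1) by (rule order_trans)

lemma product_span_submodule: "submodule (product_span M) complex_ring A"
  by (rule linear_span_submodule[OF products_carrier])

lemma product_span_subset: "product_span M \<subseteq> \<A> 0"
  by (rule linear_span_minimal[OF component_submodule products_subset])

text \<open>The first factor absorbs \<open>u\<close>: u (x y) = (u x) y, and u x still has degree
  \<open>M\<close>.\<close>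

lemma product_span_left:
  assumes "u \<in> \<A> 0" "v \<in> product_span M"
  shows "u \<otimes> v \<in> product_span M"
proof (rule linear_span_mult[OF product_span_submodule _ products_carrier _ _ assms(2)])
  show "{u} \<subseteq> carrier A"
    using assms(1) component_carrier by simp
  show "u \<in> linear_span A {u}"
    by (rule subsetD[OF linear_span_superset]) simp
  fix s t
  assume s: "s \<in> {u}" and "t \<in> {x \<otimes> y | x y. x \<in> \<A> M \<and> y \<in> \<A> (- M)}"
  then obtain x y where xy: "x \<in> \<A> M" "y \<in> \<A> (- M)" "t = x \<otimes> y"
    by blast
  have "s \<otimes> t = (u \<otimes> x) \<otimes> y"
    using s xy assms(1) by (simp add: m_assoc component_carrier)
  moreover have "u \<otimes> x \<in> \<A> M"
    using component_mult[OF assms(1) xy(1)] by simp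
  ultimately have "s \<otimes> t \<in> {x \<otimes> y | x y. x \<in> \<A> M \<and> y \<in> \<A> (- M)}"
    using xy(2) by blast
  then show "s \<otimes> t \<in> product_span M"
    by (rule subsetD[OF linear_span_superset])
qed

lemma product_span_right:
  assumes "u \<in> \<A> 0" "v \<in> product_span M"
  shows "v \<otimes> u \<in> product_span M"
proof (rule linear_span_mult[OF product_span_submodule products_carrier _ _ assms(2)])
  show "{u} \<subseteq> carrier A"
    using assms(1) component_carrier by simp
  show "u \<in> linear_span A {u}"
    by (rule subsetD[OF linear_span_superset]) simp
  fix t s
  assume s: "s \<in> {u}" and "t \<in> {x \<otimes> y | x y. x \<in> \<A> M \<and> y \<in> \<A> (- M)}"
  then obtain x y where xy: "x \<in> \<A> M" "y \<in> \<A> (- M)" "t = x \<otimes> y"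
    by blast
  have "t \<otimes> s = x \<otimes> (y \<otimes> u)"
    using s xy assms(1) by (simp add: m_assoc component_carrier)
  moreover have "y \<otimes> u \<in> \<A> (- M)"
    using component_mult[OF xy(2) assms(1)] by simp
  ultimately have "t \<otimes> s \<in> {x \<otimes> y | x y. x \<in> \<A> M \<and> y \<in> \<A> (- M)}"
    using xy(1) by blast
  then show "t \<otimes> s \<in> product_span M"
    by (rule subsetD[OF linear_span_superset])
qed

lemma component_pow:
  assumes "\<one> \<in> \<A> 0" "x \<in> \<A> k"
  shows "x [^] (l::nat) \<in> \<A> (int l * k)"
proof (induction l)
  case (Suc l)
  have "x [^] l \<otimes> x \<in> \<A> (int l * k + k)"
    using Suc assms(2) by (rule component_mult)
  then show ?case
    by (simp add: algebra_simps)
qed (use assms(1) in simp)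

text \<open>The degrees \<open>d i\<close> and \<open>M\<close> are arbitrary integers and the pair
  \<open>a\<close>, \<open>b\<close> is abstract, so that the generators and their adjoints can
  exchange roles according to the sign of \<open>M\<close>.\<close>

lemma one_in_product_span:
  fixes n :: nat and l :: "nat \<Rightarrow> nat"
  assumes one: "\<one> \<in> \<A> 0"
    and y: "\<And>i. y i \<in> \<A> 0" "y 0 = \<one>" "y (Suc n) = \<zero>"
    and a: "\<And>i. i \<le> n \<Longrightarrow> a i \<in> \<A> (d i)" and b: "\<And>i. i \<le> n \<Longrightarrow> b i \<in> \<A> (- d i)"
    and l: "\<And>i. i \<le> n \<Longrightarrow> int (l i) * d i = M"
    and yy: "\<And>i. i \<le> n \<Longrightarrow> y i \<otimes> y (Suc i) = y (Suc i) \<otimes> y i"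
    and ab: "\<And>i. i \<le> n \<Longrightarrow> a i \<otimes> b i = y i \<oplus> c \<odot> y (Suc i)"
    and ay: "\<And>i. i \<le> n \<Longrightarrow> a i \<otimes> y i = y i \<otimes> a i"
    and ay': "\<And>i. i \<le> n \<Longrightarrow> a i \<otimes> y (Suc i) = t \<odot> (y (Suc i) \<otimes> a i)"
  shows "\<one> \<in> product_span M"
proof -
  let ?J = "product_span M"
  note J = product_span_submodule[of M] and D = submoduleD[OF product_span_submodule[of M]]
  have H_mult: "u \<otimes> v \<in> \<A> 0" if "u \<in> \<A> 0" "v \<in> \<A> 0" for u v
    using component_mult[OF that] by simp
  have "\<exists>k::nat. y i [^] k \<in> ?J" if "i \<le> Suc n" for i
    using that
  proof (induction rule: inc_induct)
    case base
    \<comment> \<open>The exponent is 1 because the power 0 would be the unit itself.\<close>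
    have "y (Suc n) [^] (1::nat) \<in> ?J"
      using y(3) D(2) by simp
    then show ?case ..
  next
    case (step i)
    then have i: "i \<le> n"
      by simp
    obtain k :: nat where k: "y (Suc i) [^] k \<in> ?J"
      using step.IH by blast
    obtain r where r: "r \<in> \<A> 0" "r \<otimes> y (Suc i) = y (Suc i) \<otimes> r"
      "a i [^] l i \<otimes> b i [^] l i = y i [^] l i \<oplus> y (Suc i) \<otimes> r"
      using pow_mult_pow_expand[OF component_submodule one H_mult y(1) y(1) yy[OF i]
          component_carrier[OF a[OF i]] component_carrier[OF b[OF i]] ab[OF i] ay[OF i] ay'[OF i]]
      by blast
    define p where "p = a i [^] l i \<otimes> b i [^] l i"
    \<comment> \<open>The sign is chosen such that \<open>p\<close> and \<open>s\<close> add up to a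
      power of \<open>y i\<close>.\<close>
    define s where "s = y (Suc i) \<otimes> \<ominus> r"
    have carr: "y j \<in> carrier A" "r \<in> carrier A" for j
      using y(1) r(1) by (auto intro: component_carrier)
    have "a i [^] l i \<in> \<A> M" "b i [^] l i \<in> \<A> (- M)"
      using component_pow[OF one a[OF i], of "l i"] component_pow[OF one b[OF i], of "l i"] l[OF i]
      by simp_all
    then have "p \<in> {x \<otimes> y | x y. x \<in> \<A> M \<and> y \<in> \<A> (- M)}"
      unfolding p_def by blast
    then have p: "p \<in> ?J"
      by (rule subsetD[OF linear_span_superset])
    have s: "s \<in> \<A> 0"
      unfolding s_def using y(1) r(1) componentD(5) by (intro H_mult)
    obtain j where j: "j \<in> ?J" "(p \<oplus> s) [^] k = j \<oplus> s [^] k"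
      using add_pow_mod[OF component_submodule one H_mult J product_span_subset
          product_span_left product_span_right p s, of k] by blast
    have "p \<oplus> s = y i [^] l i"
      using carr by (simp add: p_def s_def r(3) r_minus a_assoc r_neg)
    then have "y i [^] (l i * k) = j \<oplus> s [^] k"
      using j(2) carr by (simp add: nat_pow_pow)
    \<comment> \<open>Here the commutation of \<open>r\<close> with \<open>y (Suc i)\<close> pays
      off: the power splits, and its first factor lies in the ideal by the induction
      hypothesis.\<close>
    moreover have "s [^] k = y (Suc i) [^] k \<otimes> (\<ominus> r) [^] k"
      unfolding s_def by (rule pow_mult_distrib) (use carr r(2) in \<open>simp_all add: l_minus r_minus\<close>)
    moreover have "(\<ominus> r) [^] k \<in> \<A> 0"
      using component_pow[OF one componentD(5)[OF r(1)], of k] by simp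
    ultimately have "y i [^] (l i * k) \<in> ?J"
      using j(1) k product_span_right D(3) by simp
    then show ?case ..
  qed
  from this[of 0] show ?thesis
    using y(2) by simp
qed

end

section \<open>The quantum sphere relations\<close>

text \<open>The adjoints form a second family \<open>zs\<close>, without a star operation.
  \<open>zs_zs\<close> therefore records what the adjoint of \<open>z_z\<close> says for real
  \<open>q\<close>.\<close>

locale quantum_sphere = graded_algebra_ring A \<A>
  for A :: "(complex, 'a, 'm) module_scheme" (structure) and \<A> :: "int \<Rightarrow> 'a set" +
  fixes q :: complex and n :: nat and m :: "nat \<Rightarrow> nat" and z zs :: "nat \<Rightarrow> 'a"
  assumes q_nonzero: "q \<noteq> 0" and one_component: "\<one> \<in> \<A> 0"
    and z_component: "i \<le> n \<Longrightarrow> z i \<in> \<A> (int (m i))"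
    and zs_component: "i \<le> n \<Longrightarrow> zs i \<in> \<A> (- int (m i))"
    and z_z: "i < j \<Longrightarrow> j \<le> n \<Longrightarrow> z i \<otimes> z j = q \<odot> (z j \<otimes> z i)"
    and z_zs: "i \<le> n \<Longrightarrow> j \<le> n \<Longrightarrow> i \<noteq> j \<Longrightarrow> z i \<otimes> zs j = q \<odot> (zs j \<otimes> z i)"
    and zs_zs: "i < j \<Longrightarrow> j \<le> n \<Longrightarrow> zs j \<otimes> zs i = q \<odot> (zs i \<otimes> zs j)"
    and z_zs_same: "i \<le> n \<Longrightarrow> z i \<otimes> zs i =
      zs i \<otimes> z i \<oplus> (q powi (-2) - 1) \<odot> (\<Oplus>j\<in>{Suc i..n}. z j \<otimes> zs j)"
    and sum_z_zs: "(\<Oplus>j\<in>{0..n}. z j \<otimes> zs j) = \<one>"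
begin

text \<open>The y_i of the overview.\<close>

definition tail :: "nat \<Rightarrow> 'a" where "tail i = (\<Oplus>j\<in>{i..n}. z j \<otimes> zs j)"

lemma z_carrier [simp]: "i \<le> n \<Longrightarrow> z i \<in> carrier A"
  using z_component component_carrier by blast

lemma zs_carrier [simp]: "i \<le> n \<Longrightarrow> zs i \<in> carrier A"
  using zs_component component_carrier by blast

lemma tail_component: "tail i \<in> \<A> 0"
  unfolding tail_def
proof (rule submodule_finsum[OF component_submodule])
  fix j
  assume "j \<in> {i..n}"
  then show "z j \<otimes> zs j \<in> \<A> 0"
    using component_mult[OF z_component zs_component, of j j] by simp
qed

lemma tail_carrier [simp]: "tail i \<in> carrier A"
  using tail_component component_carrier by blast

lemma tail_0: "tail 0 = \<one>"
  by (simp add: tail_def sum_z_zs)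

lemma tail_Suc_n: "tail (Suc n) = \<zero>"
  by (simp add: tail_def)

lemma tail_step:
  assumes "i \<le> n"
  shows "tail i = z i \<otimes> zs i \<oplus> tail (Suc i)"
proof -
  have "{i..n} = insert i {Suc i..n}"
    using assms by auto
  then show ?thesis
    using assms by (simp add: tail_def Pi_iff)
qed

text \<open>The coefficient is (q^(-2) - 1) + 1: the first part comes from exchanging z_i and zs_i,
  the second is the tail already present.\<close>

lemma tail_step':
  assumes "i \<le> n"
  shows "tail i = zs i \<otimes> z i \<oplus> q powi (-2) \<odot> tail (Suc i)"
proof -
  have "tail i = zs i \<otimes> z i \<oplus> ((q powi (-2) - 1) \<odot> tail (Suc i) \<oplus> 1 \<odot> tail (Suc i))"
    using assms by (simp add: tail_step z_zs_same a_assoc flip: tail_def)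
  then show ?thesis
    using smult_l_distr[of "tail (Suc i)" "q powi (-2) - 1" 1] by simp
qed

text \<open>For fixed \<open>a\<close> and \<open>t\<close> the condition is linear in the other
  element, so it passes from the summands to the sum.\<close>

lemma commute_tail:
  assumes a: "a \<in> carrier A"
    and "\<And>j. j \<in> {i..n} \<Longrightarrow> a \<otimes> (z j \<otimes> zs j) = t \<odot> ((z j \<otimes> zs j) \<otimes> a)"
  shows "a \<otimes> tail i = t \<odot> (tail i \<otimes> a)"
proof -
  have "submodule {x \<in> carrier A. a \<otimes> x = t \<odot> (x \<otimes> a)} complex_ring A"
    by (rule submoduleI)
      (use a in \<open>auto simp: l_distr r_distr smult_r_distr smult_mult_left smult_mult_right
        smult_smult mult.commute\<close>)
  then have "tail i \<in> {x \<in> carrier A. a \<otimes> x = t \<odot> (x \<otimes> a)}"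
    unfolding tail_def by (rule submodule_finsum) (use assms in auto)
  then show ?thesis
    by simp
qed

text \<open>For j > i, crossing z_j and crossing zs_j cost one factor q each.\<close>

lemma z_tail:
  assumes "i \<le> n"
  shows "z i \<otimes> tail (Suc i) = q\<^sup>2 \<odot> (tail (Suc i) \<otimes> z i)"
proof (rule commute_tail)
  fix j
  assume j: "j \<in> {Suc i..n}"
  then have c: "z i \<in> carrier A" "z j \<in> carrier A" "zs j \<in> carrier A"
    using assms by auto
  have "z i \<otimes> (z j \<otimes> zs j) = q \<odot> (z j \<otimes> (z i \<otimes> zs j))"
    using z_z[of i j] c j by (simp add: smult_mult_left m_assoc flip: m_assoc[of "z i"])
  also have "\<dots> = q\<^sup>2 \<odot> ((z j \<otimes> zs j) \<otimes> z i)"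
    using z_zs[of i j] c j assms
    by (simp add: smult_mult_right smult_smult power2_eq_square m_assoc)
  finally show "z i \<otimes> (z j \<otimes> zs j) = q\<^sup>2 \<odot> ((z j \<otimes> zs j) \<otimes> z i)" .
qed (use assms in simp)

text \<open>In \<open>z_zs\<close> and \<open>zs_zs\<close> the factor zs_i starts on the right of
  z_j and zs_j. Both relations are thus read backwards, whence the inverse powers of q.\<close>

lemma zs_tail:
  assumes "i \<le> n"
  shows "zs i \<otimes> tail (Suc i) = q powi (-2) \<odot> (tail (Suc i) \<otimes> zs i)"
proof (rule commute_tail)
  fix j
  assume j: "j \<in> {Suc i..n}"
  then have c: "zs i \<in> carrier A" "z j \<in> carrier A" "zs j \<in> carrier A"
    using assms by auto
  have swap: "y = inverse q \<odot> x" if "x = q \<odot> y" "y \<in> carrier A" for x y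
    using that q_nonzero by (simp add: smult_smult)
  have 1: "zs i \<otimes> z j = inverse q \<odot> (z j \<otimes> zs i)"
    using z_zs[of j i] c j assms by (intro swap) auto
  have 2: "zs i \<otimes> zs j = inverse q \<odot> (zs j \<otimes> zs i)"
    using zs_zs[of i j] c j assms by (intro swap) auto
  have "zs i \<otimes> (z j \<otimes> zs j) = inverse q \<odot> (z j \<otimes> (zs i \<otimes> zs j))"
    using c by (simp add: 1 smult_mult_left m_assoc flip: m_assoc[of "zs i"])
  also have "\<dots> = (inverse q * inverse q) \<odot> ((z j \<otimes> zs j) \<otimes> zs i)"
    using c by (simp add: 2 smult_mult_right smult_smult m_assoc)
  also have "inverse q * inverse q = q powi (-2)"
    by (simp add: power_int_def power2_eq_square)
  finally show "zs i \<otimes> (z j \<otimes> zs j) = q powi (-2) \<odot> ((z j \<otimes> zs j) \<otimes> zs i)" .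
qed (use assms in simp)

lemma q_powi_q2: "q powi (-2) * q\<^sup>2 = 1" "q\<^sup>2 * q powi (-2) = 1"
  using q_nonzero by (simp_all add: power_int_def field_simps)

text \<open>On the left y_i is expanded by \<open>tail_step'\<close>, on the right by
  \<open>tail_step\<close>. The q^(-2) of the former cancels the q^2 of \<open>z_tail\<close>, and
  both sides become z_i zs_i z_i + y_{i+1} z_i.\<close>

lemma z_tail_same:
  assumes "i \<le> n"
  shows "z i \<otimes> tail i = tail i \<otimes> z i"
proof -
  have "z i \<otimes> tail i = z i \<otimes> zs i \<otimes> z i \<oplus> tail (Suc i) \<otimes> z i"
    using assms
    by (simp add: tail_step' r_distr smult_mult_right z_tail smult_smult q_powi_q2 m_assoc)
  also have "\<dots> = tail i \<otimes> z i"
    using assms by (simp add: tail_step l_distr)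
  finally show ?thesis .
qed

text \<open>As for z_i, with the two expansions of y_i exchanged.\<close>

lemma zs_tail_same:
  assumes "i \<le> n"
  shows "zs i \<otimes> tail i = tail i \<otimes> zs i"
proof -
  have "zs i \<otimes> tail i = zs i \<otimes> z i \<otimes> zs i \<oplus> q powi (-2) \<odot> (tail (Suc i) \<otimes> zs i)"
    using assms by (simp add: tail_step r_distr zs_tail m_assoc)
  also have "\<dots> = tail i \<otimes> zs i"
    using assms by (simp add: tail_step' l_distr smult_mult_left)
  finally show ?thesis .
qed

text \<open>The factors q^(-2) from zs_i and q^2 from z_i cancel, so z_i zs_i commutes with
  y_{i+1}.\<close>

lemma tail_tail:
  assumes "i \<le> n"
  shows "tail i \<otimes> tail (Suc i) = tail (Suc i) \<otimes> tail i"
proof -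
  have "z i \<otimes> zs i \<otimes> tail (Suc i) = q powi (-2) \<odot> ((z i \<otimes> tail (Suc i)) \<otimes> zs i)"
    using assms by (simp add: m_assoc zs_tail smult_mult_right)
  also have "\<dots> = tail (Suc i) \<otimes> (z i \<otimes> zs i)"
    using assms by (simp add: z_tail smult_mult_left smult_smult q_powi_q2 m_assoc)
  finally show ?thesis
    using assms by (simp add: tail_step l_distr r_distr)
qed

lemma one_in_product_span_veronese:
  assumes m: "\<And>i. i \<le> n \<Longrightarrow> 0 < m i"
  defines "N \<equiv> \<Prod>i=0..n. m i"
  shows "\<one> \<in> product_span (k * int N)"
proof -
  have dvd: "m i dvd N" if "i \<le> n" for i
    unfolding N_def using that by (intro dvd_prodI) auto
  \<comment> \<open>As m_i divides N, this exponent brings z_i to degree |k| N.\<close>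
  have l: "int (nat \<bar>k\<bar> * (N div m i)) * int (m i) = \<bar>k\<bar> * int N" if "i \<le> n" for i
  proof -
    have "int (N div m i) * int (m i) = int N"
      using dvd[OF that] by (simp flip: of_nat_mult)
    then show ?thesis
      by (simp add: mult.assoc)
  qed
  have add_minus: "x = x \<oplus> c \<odot> y \<oplus> (- c) \<odot> y" if "x \<in> carrier A" "y \<in> carrier A" for x y c
    using that by (simp add: a_assoc flip: smult_l_distr)
  show ?thesis
  proof (cases "0 \<le> k")
    case True
    show ?thesis
    \<comment> \<open>For k >= 0 the powers of z_i have the required degree; \<open>c\<close> stems
      from \<open>tail_step\<close> and \<open>t\<close> from \<open>z_tail\<close>.\<close>
    proof (rule one_in_product_span[where y = tail and a = z and b = zs and d = "\<lambda>i. int (m i)"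
          and l = "\<lambda>i. nat \<bar>k\<bar> * (N div m i)" and c = "- 1" and t = "q\<^sup>2" and n = n])
      show "z i \<otimes> zs i = tail i \<oplus> (- 1) \<odot> tail (Suc i)" if "i \<le> n" for i
        using add_minus[of "z i \<otimes> zs i" "tail (Suc i)" 1] that by (simp add: tail_step)
    qed (use True l in \<open>simp_all add: one_component tail_component tail_0 tail_Suc_n
        z_component zs_component tail_tail z_tail_same z_tail\<close>)
  next
    case False
    show ?thesis
    \<comment> \<open>For k < 0 the adjoints come first; \<open>c\<close> and \<open>t\<close> are
      now those of \<open>tail_step'\<close> and \<open>zs_tail\<close>.\<close>
    proof (rule one_in_product_span[where y = tail and a = zs and b = z and d = "\<lambda>i. - int (m i)"
          and l = "\<lambda>i. nat \<bar>k\<bar> * (N div m i)" and c = "- (q powi (-2))" and t = "q powi (-2)" and n = n])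
      show "zs i \<otimes> z i = tail i \<oplus> (- (q powi (-2))) \<odot> tail (Suc i)" if "i \<le> n" for i
        using add_minus[of "zs i \<otimes> z i" "tail (Suc i)" "q powi (-2)"] that by (simp add: tail_step')
      show "int (nat \<bar>k\<bar> * (N div m i)) * - int (m i) = k * int N" if "i \<le> n" for i
        using l[OF that] False by simp
    qed (simp_all add: one_component tail_component tail_0 tail_Suc_n
        z_component zs_component tail_tail zs_tail_same zs_tail)
  qed
qed

end

text \<open>Generators and relations beyond those of the sphere are permitted, so that the
  presentation with the extra unitary \<open>w\<close> is an instance too.\<close>

locale sphere_presentation = star_presentation G R "gen_degree n m"
  for G :: "gen set" and R and n :: nat and m :: "nat \<Rightarrow> nat" +
  fixes q :: real
  assumes q_pos: "0 < q" and m_pos: "i \<le> n \<Longrightarrow> 0 < m i"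
    and gens: "i \<le> n \<Longrightarrow> Gen_z i \<in> G" and rels: "sphere_relations q n \<subseteq> R"
begin

abbreviation "grading \<equiv> presented_component G R (gen_degree n m)"

lemma z_gen_component:
  assumes "i \<le> n"
  shows "z_gen i \<in> free_component G (gen_degree n m) (int (m i))"
  using free_component_gen[OF gens[OF assms], of "gen_degree n m"] by simp

lemma zs_gen_component:
  assumes "i \<le> n"
  shows "zs_gen i \<in> free_component G (gen_degree n m) (- int (m i))"
  by (rule free_component_adj[OF z_gen_component[OF assms]])

lemma gens_carrier: "i \<le> n \<Longrightarrow> z_gen i \<in> carrier F" "i \<le> n \<Longrightarrow> zs_gen i \<in> carrier F"
  using free_componentD z_gen_component zs_gen_component by blast+

lemma cls_eqI: "p \<in> carrier F \<Longrightarrow> r \<in> carrier F \<Longrightarrow> p - r \<in> I \<Longrightarrow> cls p = cls r"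
  by (simp add: cls_eq_iff)

text \<open>The relations contain sums in the free algebra, whereas \<open>quantum_sphere\<close>
  speaks of finite sums in the quotient.\<close>

lemma tail_cls:
  "(\<Oplus>\<^bsub>Q\<^esub>j\<in>{i..n}. cls (z_gen j) \<otimes>\<^bsub>Q\<^esub> cls (zs_gen j)) = cls (\<Sum>j=i..n. z_gen j * zs_gen j)"
  "(\<Sum>j=i..n. z_gen j * zs_gen j) \<in> carrier F"
proof -
  have *: "z_gen j * zs_gen j \<in> carrier F" if "j \<in> {i..n}" for j
    using that by (simp add: free_carrier_closed gens_carrier)
  have "(\<Oplus>\<^bsub>Q\<^esub>j\<in>{i..n}. cls (z_gen j) \<otimes>\<^bsub>Q\<^esub> cls (zs_gen j)) =
      (\<Oplus>\<^bsub>Q\<^esub>j\<in>{i..n}. cls (z_gen j * zs_gen j))"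
    by (rule abelian_monoid.finsum_cong'[OF abelian_group.axioms(1)[OF ring.is_abelian_group[OF ring_presented]]])
      (use * in \<open>auto simp: presented_simps gens_carrier presented_carrier\<close>)
  then show "(\<Oplus>\<^bsub>Q\<^esub>j\<in>{i..n}. cls (z_gen j) \<otimes>\<^bsub>Q\<^esub> cls (zs_gen j)) = cls (\<Sum>j=i..n. z_gen j * zs_gen j)"
    "(\<Sum>j=i..n. z_gen j * zs_gen j) \<in> carrier F"
    using cls_finsum[of "{i..n}" "\<lambda>j. z_gen j * zs_gen j"] * by simp_all
qed

lemma quantum_sphere_presented:
  "quantum_sphere Q grading q n m (\<lambda>i. cls (z_gen i)) (\<lambda>i. cls (zs_gen i))"
proof (intro quantum_sphere.intro graded_algebra_ring.intro complex_algebra_ringI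
    complex_algebra_presented graded_algebra_ring_axioms.intro graded_algebra_presented
    quantum_sphere_axioms.intro)
  note simps = presented_simps free_carrier_closed gens_carrier
  have rel: "p - r \<in> I" if "p - r \<in> sphere_relations q n" for p r
    using that rels relation_in_ideal by blast
  fix i j
  show "(of_real q :: complex) \<noteq> 0"
    using q_pos by simp
  show "\<one>\<^bsub>Q\<^esub> \<in> grading 0"
    by (auto simp: presented_simps presented_component_eq free_component_one)
  show "cls (z_gen i) \<in> grading (int (m i))" if "i \<le> n"
    using z_gen_component[OF that] by (auto simp: presented_component_eq)
  show "cls (zs_gen i) \<in> grading (- int (m i))" if "i \<le> n"
    using zs_gen_component[OF that] by (auto simp: presented_component_eq)
  show "cls (z_gen i) \<otimes>\<^bsub>Q\<^esub> cls (zs_gen j) = of_real q \<odot>\<^bsub>Q\<^esub> (cls (zs_gen j) \<otimes>\<^bsub>Q\<^esub> cls (z_gen i))"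
    if "i \<le> n" "j \<le> n" "i \<noteq> j"
  proof -
    have "z_gen i * zs_gen j - free_scale q (zs_gen j * z_gen i) \<in> I"
      by (rule rel) (use that in \<open>auto simp: sphere_relations_def\<close>)
    then show ?thesis
      using that by (simp add: simps cls_eqI)
  qed
  show zz: "cls (z_gen i) \<otimes>\<^bsub>Q\<^esub> cls (z_gen j) = of_real q \<odot>\<^bsub>Q\<^esub> (cls (z_gen j) \<otimes>\<^bsub>Q\<^esub> cls (z_gen i))"
    if "i < j" "j \<le> n"
  proof -
    have "z_gen i * z_gen j - free_scale q (z_gen j * z_gen i) \<in> I"
      by (rule rel) (use that in \<open>auto simp: sphere_relations_def\<close>)
    then show ?thesis
      using that by (simp add: simps cls_eqI)
  qed
  show "cls (zs_gen j) \<otimes>\<^bsub>Q\<^esub> cls (zs_gen i) = of_real q \<odot>\<^bsub>Q\<^esub> (cls (zs_gen i) \<otimes>\<^bsub>Q\<^esub> cls (zs_gen j))"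
    if "i < j" "j \<le> n"
    \<comment> \<open>The adjoint of the relation just shown; its scalar survives conjugation
      because \<open>q\<close> is real.\<close>
    using arg_cong[OF zz[OF that], of "adj Q"] that
    by (simp add: simps free_adj_mult free_adj_scale)
  show "cls (z_gen i) \<otimes>\<^bsub>Q\<^esub> cls (zs_gen i) = cls (zs_gen i) \<otimes>\<^bsub>Q\<^esub> cls (z_gen i) \<oplus>\<^bsub>Q\<^esub>
      (of_real q powi (-2) - 1) \<odot>\<^bsub>Q\<^esub> (\<Oplus>\<^bsub>Q\<^esub>j\<in>{Suc i..n}. cls (z_gen j) \<otimes>\<^bsub>Q\<^esub> cls (zs_gen j))"
    if "i \<le> n"
  proof -
    have "z_gen i * zs_gen i - (zs_gen i * z_gen i +
        free_scale (of_real q powi (-2) - 1) (\<Sum>j=Suc i..n. z_gen j * zs_gen j)) \<in> I"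
      by (rule rel) (use that in \<open>auto simp: sphere_relations_def\<close>)
    then show ?thesis
      using that tail_cls[of "Suc i"] by (simp add: simps cls_eqI)
  qed
  show "(\<Oplus>\<^bsub>Q\<^esub>j\<in>{0..n}. cls (z_gen j) \<otimes>\<^bsub>Q\<^esub> cls (zs_gen j)) = \<one>\<^bsub>Q\<^esub>"
  proof -
    have "(\<Sum>j=0..n. z_gen j * zs_gen j) - 1 \<in> I"
      by (rule rel) (auto simp: sphere_relations_def)
    then show ?thesis
      using tail_cls[of 0] by (simp add: simps cls_eqI)
  qed
qed

lemma veronese_principal_bundle:
  defines "N \<equiv> \<Prod>i=0..n. m i"
  shows "complex_star_algebra (veronese Q grading N)"
    and "strongly_graded_algebra (veronese Q grading N) (veronese_grading grading N)"
proof -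
  interpret S: quantum_sphere Q grading q n m "\<lambda>i. cls (z_gen i)" "\<lambda>i. cls (zs_gen i)"
    by (rule quantum_sphere_presented)
  have "0 < N"
    unfolding N_def using m_pos by (simp add: prod_pos)
  then interpret V: veronese_data Q grading N
    by (intro veronese_data.intro S.graded_algebra_ring_axioms veronese_data_axioms.intro
        S.one_component)
  show "complex_star_algebra (veronese Q grading N)"
    by (rule complex_star_algebra_veronese[OF complex_star_algebra_presented V.veronese_data_axioms
          presented_component_adj])
  show "strongly_graded_algebra (veronese Q grading N) (veronese_grading grading N)"
    unfolding N_def
    by (rule V.strongly_graded_veronese[unfolded N_def])
      (rule S.one_in_product_span_veronese[OF m_pos])
qed

end

text \<open>Exchanging two homogeneous factors preserves the degree, and z_j zs_j, zs_j z_j and 1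
  all have degree 0. The set \<open>G\<close> stays open because both presentations contain these
  relations.\<close>

lemma sphere_relations_homogeneous:
  assumes G: "\<And>i. i \<le> n \<Longrightarrow> Gen_z i \<in> G" and r: "r \<in> sphere_relations q n"
  shows "\<exists>k. r \<in> free_component G (gen_degree n m) k"
proof -
  let ?C = "free_component G (gen_degree n m)"
  have z: "z_gen i \<in> ?C (int (m i))" if "i \<le> n" for i
    using free_component_gen[OF G[OF that], of "gen_degree n m"] by simp
  have zs: "zs_gen i \<in> ?C (- int (m i))" if "i \<le> n" for i
    by (rule free_component_adj[OF z[OF that]])
  have swap: "p * p' - free_scale c (p' * p) \<in> ?C (k + l)" if "p \<in> ?C k" "p' \<in> ?C l" for p p' k l c
    using free_component_mult[OF that] free_component_mult[OF that(2,1)]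
    by (simp add: free_component_diff free_component_scale add.commute)
  have zzs: "z_gen i * zs_gen i \<in> ?C 0" "zs_gen i * z_gen i \<in> ?C 0" if "i \<le> n" for i
    using free_component_mult[OF z[OF that] zs[OF that]] free_component_mult[OF zs[OF that] z[OF that]]
    by simp_all
  have tail: "(\<Sum>j=i..n. z_gen j * zs_gen j) \<in> ?C 0" for i
    by (rule free_component_sum) (simp add: zzs)
  from r consider
      (z_z) i j where "i < j" "j \<le> n" "r = z_gen i * z_gen j - free_scale q (z_gen j * z_gen i)"
    | (z_zs) i j where "i \<le> n" "j \<le> n" "r = z_gen i * zs_gen j - free_scale q (zs_gen j * z_gen i)"
    | (same) i where "i \<le> n" "r = z_gen i * zs_gen i - (zs_gen i * z_gen i +
        free_scale (of_real q powi (-2) - 1) (\<Sum>j=Suc i..n. z_gen j * zs_gen j))"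
    | (sum) "r = (\<Sum>j=0..n. z_gen j * zs_gen j) - 1"
    unfolding sphere_relations_def by force
  then show ?thesis
  proof cases
    case z_z
    then have "i \<le> n" "j \<le> n"
      by simp_all
    from swap[OF z[OF this(1)] z[OF this(2)]] show ?thesis
      unfolding z_z(3) by blast
  next
    case z_zs
    from swap[OF z[OF z_zs(1)] zs[OF z_zs(2)]] show ?thesis
      unfolding z_zs(3) by blast
  next
    case same
    then have "r \<in> ?C 0"
      using zzs tail by (simp add: free_component_diff free_component_add free_component_scale)
    then show ?thesis ..
  next
    case sum
    show ?thesis
      unfolding sum by (intro exI[of _ 0] free_component_diff tail free_component_one)
  qed
qed

text \<open>The degree -2 m_n of \<open>w\<close> is what makes zs_n = w z_n homogeneous, with
  degree -m_n on both sides.\<close>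

lemma sigma_relations_homogeneous:
  assumes "r \<in> sigma_relations q n"
  shows "\<exists>k. r \<in> free_component (sigma_gens n) (gen_degree n m) k"
proof -
  let ?C = "free_component (sigma_gens n) (gen_degree n m)"
  have z: "z_gen i \<in> ?C (int (m i))" if "i \<le> n" for i
    using free_component_gen[of "Gen_z i" "sigma_gens n" "gen_degree n m"] that
    by (simp add: sigma_gens_def)
  have zs: "zs_gen i \<in> ?C (- int (m i))" if "i \<le> n" for i
    by (rule free_component_adj[OF z[OF that]])
  have w: "w_gen \<in> ?C (- 2 * int (m n))"
    using free_component_gen[of Gen_w "sigma_gens n" "gen_degree n m"] by (simp add: sigma_gens_def)
  have ws: "ws_gen \<in> ?C (2 * int (m n))"
    using free_component_adj[OF w] by simp
  have comm: "\<exists>k. p * p' - p' * p \<in> ?C k" if "p \<in> ?C k" "p' \<in> ?C l" for p p' k l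
    using free_component_diff[OF free_component_mult[OF that]] free_component_mult[OF that(2,1)]
    by (metis add.commute)
  from assms consider
      (sphere) "r \<in> sphere_relations q n"
    | (wz) i where "i \<le> n" "r = w_gen * z_gen i - z_gen i * w_gen"
    | (wzs) i where "i \<le> n" "r = w_gen * zs_gen i - zs_gen i * w_gen"
    | (wws) "r = w_gen * ws_gen - 1 \<or> r = ws_gen * w_gen - 1"
    | (zsn) "r = zs_gen n - w_gen * z_gen n"
    unfolding sigma_relations_def by blast
  then show ?thesis
  proof cases
    case sphere
    then show ?thesis
      by (rule sphere_relations_homogeneous[rotated]) (simp add: sigma_gens_def)
  next
    case wz
    then show ?thesis
      using comm[OF w z] by simp
  next
    case wzs
    then show ?thesis
      using comm[OF w zs] by simp
  next
    case wws
    then have "r \<in> ?C 0"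
      using free_component_mult[OF w ws] free_component_mult[OF ws w] free_component_one
      by (auto intro: free_component_diff)
    then show ?thesis ..
  next
    case zsn
    then have "r \<in> ?C (- int (m n))"
      using free_component_mult[OF w z[of n]] zs[of n] by (auto intro: free_component_diff)
    then show ?thesis ..
  qed
qed

theorem proposition4p2:
  fixes q :: real and n :: nat and m :: "nat \<Rightarrow> nat"
  assumes "0 < q" and "q < 1"
    and "1 \<le> n"
    and "\<And>i. i \<le> n \<Longrightarrow> 0 < m i"
  defines "N \<equiv> (\<Prod>i=0..n. m i)"
  shows "complex_star_algebra (lens_algebra q n N m)
    \<and> complex_star_algebra (sigma_lens_algebra q n N m)
    \<and> strongly_graded_algebra (lens_algebra q n N m) (lens_grading q n N m)
    \<and> strongly_graded_algebra (sigma_lens_algebra q n N m) (sigma_lens_grading q n N m)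
    \<and> circle_principal_bundle (lens_algebra q n N m) (lens_grading q n N m) (WP_algebra q n m)
    \<and> circle_principal_bundle (sigma_lens_algebra q n N m) (sigma_lens_grading q n N m)
        (RP_algebra q n m)"
proof -
  have z: "Gen_z i \<in> sphere_gens n" "Gen_z i \<in> sigma_gens n" if "i \<le> n" for i
    using that by (simp_all add: sphere_gens_def sigma_gens_def)
  interpret sphere: sphere_presentation "sphere_gens n" "sphere_relations q n" n m q
    by unfold_locales (use assms z sphere_relations_homogeneous in auto)
  interpret sigma: sphere_presentation "sigma_gens n" "sigma_relations q n" n m q
    by unfold_locales
      (use assms z sigma_relations_homogeneous in \<open>auto simp: sigma_relations_def\<close>)
  note defs = lens_algebra_def lens_grading_def sphere_algebra_def sphere_grading_def WP_algebra_def
    sigma_lens_algebra_def sigma_lens_grading_def sigma_algebra_def sigma_grading_def RP_algebra_def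
  \<comment> \<open>\<open>veronese\<close> changes only the carrier, which
    \<open>degree_zero_part\<close> overwrites, and degree 0 is fixed by the rescaling.\<close>
  have degree_zero: "degree_zero_part (veronese A \<A> N) (veronese_grading \<A> N) = degree_zero_part A \<A>"
    for A :: "gen free_star set star_alg" and \<A>
    by (simp add: degree_zero_part_def veronese_def veronese_grading_def)
  show ?thesis
    using sphere.veronese_principal_bundle sigma.veronese_principal_bundle
    by (simp add: defs degree_zero circle_principal_bundle_def flip: N_def)
qed

end
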